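(* Forcing with the Sacks forcing $\mathbb{S}$ forces that the continuum has the same cardinality as the ground-model cardinal $\mathfrak{b}^{+\epsilon}$; that is, $\Vdash_{\mathbb{S}} \mathfrak{c}=|(\mathfrak{b}^{+\epsilon})^{V}|$.
   Context: The Sacks forcing $\mathbb{S}$ consists of all perfect trees $T\subseteq 2^{<\omega}$, ordered by reverse inclusion (a smaller tree is a stronger condition). $[\omega]^{\omega}$ denotes the set of infinite subsets of $\omega$, and for $X\in[\omega]^\omega$, $\mu_X:\omega\to X$ is the increasing enumeration of $X$. A family $\mathcal{F}\subseteq[\omega]^\omega$ is weakly dominating if for every $Y\in[\omega]^\omega$ there is $X\in\mathcal{F}$ such that for infinitely many $i\in\omega$, for all $j<2^i$, $|[\mu_X(2^i+j),\mu_X(2^i+j+1))\cap Y|\geq 2$. The cardinal $\mathfrak{b}^{+\epsilon}$ is the minimal cardinality of a weakly dominating family. $\mathfrak{c}$ denotes the cardinality of the continuum; $(\mathfrak{b}^{+\epsilon})^V$ is the value of $\mathfrak{b}^{+\epsilon}$ computed in the ground model. *)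

theory Defs
  imports "HOL-Library.Infinite_Set" "HOL-Library.Sublist" "HOL-Library.Multiset"
begin

unbundle cardinal_syntax

section \<open>Weakly dominating families\<close>

definition weakly_dominating :: "nat set set \<Rightarrow> bool" where
  "weakly_dominating F \<longleftrightarrow> F \<subseteq> {X. infinite X} \<and>
     (\<forall>Y. infinite Y \<longrightarrow> (\<exists>X\<in>F. \<exists>\<^sub>\<infinity>i. \<forall>j<2^i.
        card ({enumerate X (2^i + j)..<enumerate X (2^i + j + 1)} \<inter> Y) \<ge> 2))"

text \<open>As usual in HOL, a cardinal is a well-order isomorphic to an initial ordinal, and
  \<open>|F|\<close> is such a well-order with field \<open>F\<close>.\<close>

definition b_plus_epsilon :: "nat set rel" where
  "b_plus_epsilon = (SOME \<kappa>. (\<exists>F. weakly_dominating F \<and> \<kappa> = |F| ) \<and>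
     (\<forall>G. weakly_dominating G \<longrightarrow> \<kappa> \<le>o |G| ))"

lemma weakly_dominating_all: "weakly_dominating {X. infinite X}"
proof -
  have "\<exists>X. infinite X \<and> (\<forall>n. card ({enumerate X n..<enumerate X (n + 1)} \<inter> Y) \<ge> 2)"
    if Y: "infinite Y" for Y :: "nat set"
  proof -
    define f where "f n = enumerate Y (2 * n)" for n
    have sY: "strict_mono (enumerate Y)"
      using Y by (simp add: strict_mono_enumerate)
    have sf: "strict_mono f"
      unfolding f_def using sY by (auto simp: strict_mono_def)
    have inf: "infinite (range f)"
      using sf by (simp add: range_inj_infinite strict_mono_imp_inj_on)
    have en: "enumerate (range f) n = f n" for n
    proof (induction n rule: less_induct)
      case (less n)
      have "enumerate (range f) n = (LEAST s. s \<in> range f \<and> (\<forall>k<n. enumerate (range f) k < s))"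
      proof (rule Least_equality[symmetric])
        show "enumerate (range f) n \<in> range f \<and>
            (\<forall>k<n. enumerate (range f) k < enumerate (range f) n)"
          using inf by (auto simp: enumerate_in_set enumerate_mono)
        fix y assume y: "y \<in> range f \<and> (\<forall>k<n. enumerate (range f) k < y)"
        then obtain m where m: "enumerate (range f) m = y"
          using enumerate_Ex[OF inf] by blast
        have "\<not> m < n" using y m by auto
        then show "enumerate (range f) n \<le> y"
          using m[symmetric] strict_mono_less_eq[OF strict_mono_enumerate[OF inf]] by simp
      qed
      also have "\<dots> = f n"
      proof (rule Least_equality)
        show "f n \<in> range f \<and> (\<forall>k<n. enumerate (range f) k < f n)"
          using less sf by (auto simp: strict_mono_def)
        fix y assume y: "y \<in> range f \<and> (\<forall>k<n. enumerate (range f) k < y)"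
        then obtain m where m: "y = f m" by blast
        have "\<not> m < n" using y m less.IH by auto
        then show "f n \<le> y" using m sf by (simp add: strict_mono_less_eq)
      qed
      finally show ?case .
    qed
    have "card ({f n..<f (n + 1)} \<inter> Y) \<ge> 2" for n
    proof -
      have "{enumerate Y (2 * n), enumerate Y (2 * n + 1)} \<subseteq> {f n..<f (n + 1)} \<inter> Y"
        using sY Y by (auto simp: f_def enumerate_in_set strict_mono_def less_imp_le)
      moreover have "card {enumerate Y (2 * n), enumerate Y (2 * n + 1)} = 2"
        using sY by (auto simp: card_2_iff strict_mono_eq)
      ultimately show ?thesis
        by (metis card_mono finite_Int finite_atLeastLessThan)
    qed
    then show ?thesis using inf en by auto
  qed
  then show ?thesis
    unfolding weakly_dominating_def INFM_nat by blast
qed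

lemma b_plus_epsilon:
  "(\<exists>F. weakly_dominating F \<and> b_plus_epsilon = |F| ) \<and>
   (\<forall>G. weakly_dominating G \<longrightarrow> b_plus_epsilon \<le>o |G| )"
  unfolding b_plus_epsilon_def
proof (rule someI_ex)
  let ?R = "card_of ` {F. weakly_dominating F}"
  have "?R \<noteq> {}" "\<forall>r\<in>?R. Card_order r"
    using weakly_dominating_all by (auto simp: card_of_Card_order)
  from exists_minim_Card_order[OF this]
  show "\<exists>\<kappa>. (\<exists>F. weakly_dominating F \<and> \<kappa> = |F| ) \<and> (\<forall>G. weakly_dominating G \<longrightarrow> \<kappa> \<le>o |G| )"
    by auto
qed

section \<open>Sacks forcing\<close>

definition perfect_tree :: "bool list set \<Rightarrow> bool" where
  "perfect_tree T \<longleftrightarrow> T \<noteq> {} \<and> (\<forall>t\<in>T. \<forall>s. prefix s t \<longrightarrow> s \<in> T) \<and>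
     (\<forall>s\<in>T. \<exists>t. prefix s t \<and> t @ [False] \<in> T \<and> t @ [True] \<in> T)"

typedef sacks = "{T. perfect_tree T}"
  morphisms tree Sacks
  by (rule exI[of _ UNIV]) (auto simp: perfect_tree_def)

text \<open>Smaller conditions are stronger, here and below.\<close>

instantiation sacks :: order_top
begin

definition "S \<le> T \<longleftrightarrow> tree S \<subseteq> tree T"
definition "S < T \<longleftrightarrow> tree S \<subset> tree T"
definition "top = Sacks UNIV"

instance
proof
  have "tree top = UNIV"
    unfolding top_sacks_def by (rule Sacks_inverse) (auto simp: perfect_tree_def)
  then show "S \<le> top" for S :: sacks by (simp add: less_eq_sacks_def)
qed (auto simp: less_eq_sacks_def less_sacks_def tree_inject)

end

section \<open>Names\<close>

text \<open>A name for a forcing notion \<open>'p\<close> is a set of pairs of a name and a condition. Since there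
  is no type of all such sets, the sets are indexed by (a part of) a type \<open>'i\<close>. So \<open>('i, 'p) name\<close>
  consists of the names that, hereditarily, have at most \<open>|'i|\<close> elements; they denote the elements
  of $H(|{'i}|^+)$ in the generic extension of the universe, provided \<open>|'p| \<le> |'i|\<close> and \<open>'i\<close> is
  infinite.\<close>

datatype ('i, 'p) name = Name "'i \<Rightarrow> (('i, 'p) name \<times> 'p) option"

primrec elts :: "('i, 'p) name \<Rightarrow> (('i, 'p) name \<times> 'p) set" where
  "elts (Name f) = ran f"

text \<open>Different \<open>Name f\<close> may have the same elements; the choice is irrelevant, as forcing only
  refers to \<open>elts\<close>.\<close>

definition name_of :: "(('i, 'p) name \<times> 'p) set \<Rightarrow> ('i, 'p) name" where
  "name_of A = (SOME a. elts a = A)"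

lemma elts_name_of:
  fixes A :: "(('i, 'p) name \<times> 'p) set"
  assumes "|A| \<le>o |UNIV :: 'i set|"
  shows "elts (name_of A) = A"
proof -
  obtain g :: "_ \<Rightarrow> 'i" where g: "inj_on g A"
    using assms card_of_ordLeq[of A "UNIV :: 'i set"] by auto
  have "elts (Name (\<lambda>i. if i \<in> g ` A then Some (inv_into A g i) else None)) = A"
    using g by (auto simp: ran_def image_iff split: if_splits)
      (metis inv_into_f_f)+
  then show ?thesis
    unfolding name_of_def by (rule someI)
qed

text \<open>The canonical name $\check\alpha$ of the von Neumann ordinal isomorphic to a well-order
  \<open>r\<close>; \<open>segment_check r x\<close> is the one for the initial segment of \<open>r\<close> strictly below \<open>x\<close>.\<close>

definition segment_check :: "'a rel \<Rightarrow> 'a \<Rightarrow> ('i, 'p::order_top) name" where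
  "segment_check r = wfrec (r - Id) (\<lambda>h x. name_of ((\<lambda>y. (h y, top)) ` underS r x))"

definition ordinal_check :: "'a rel \<Rightarrow> ('i, 'p::order_top) name" where
  "ordinal_check r = name_of ((\<lambda>x. (segment_check r x, top)) ` Field r)"

lemma elts_segment_check:
  assumes "Well_order r" "|Field r| \<le>o |UNIV :: 'i set|"
  shows "elts (segment_check r x :: ('i, 'p::order_top) name) =
    (\<lambda>y. (segment_check r y, top)) ` underS r x"
proof -
  let ?h = "segment_check r :: _ \<Rightarrow> ('i, 'p) name"
  have wf: "wf (r - Id)" using assms(1) by (simp add: well_order_on_def)
  have "?h x = name_of ((\<lambda>y. (cut ?h (r - Id) x y, top)) ` underS r x)"
    unfolding segment_check_def by (subst wfrec[OF wf]) simp
  also have "(\<lambda>y. (cut ?h (r - Id) x y, top :: 'p)) ` underS r x = (\<lambda>y. (?h y, top)) ` underS r x"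
    by (rule image_cong) (auto simp: cut_def underS_def)
  finally have eq: "?h x = name_of ((\<lambda>y. (?h y, top)) ` underS r x)" .
  have "|(\<lambda>y. (?h y, top :: 'p)) ` underS r x| \<le>o |underS r x|" by (rule card_of_image)
  also have "|underS r x| \<le>o |Field r|" by (rule card_of_mono1) (auto simp: underS_def Field_def)
  also note assms(2)
  finally show ?thesis by (subst eq) (rule elts_name_of)
qed

lemma elts_ordinal_check:
  assumes "|Field r| \<le>o |UNIV :: 'i set|"
  shows "elts (ordinal_check r :: ('i, 'p::order_top) name) =
    (\<lambda>x. (segment_check r x, top)) ` Field r"
  unfolding ordinal_check_def
  by (rule elts_name_of) (rule ordLeq_transitive[OF card_of_image assms])

section \<open>The forcing relation\<close>

lemma name_wf: "wf {(a, b :: ('i, 'p) name). a \<in> fst ` elts b}"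
proof (rule wfUNIVI)
  fix P :: "('i, 'p) name \<Rightarrow> bool" and x :: "('i, 'p) name"
  assume "\<forall>x. (\<forall>y. (y, x) \<in> {(a, b). a \<in> fst ` elts b} \<longrightarrow> P y) \<longrightarrow> P x"
  then have step: "P x" if "\<And>y. y \<in> fst ` elts x \<Longrightarrow> P y" for x using that by auto
  show "P x"
  proof (induction x)
    case (Name f)
    show ?case
    proof (rule step)
      fix y assume "y \<in> fst ` elts (Name f)"
      then obtain p i where "f i = Some (y, p)" by (auto simp: ran_def)
      moreover from this have "Some (y, p) \<in> range f" by (metis rangeI)
      ultimately show "P y" using Name[of "f i" "(y, p)" y] by (auto simp: fsts.simps)
    qed
  qed
qed

function
  forces_eq :: "'p::order_top \<Rightarrow> ('i, 'p) name \<Rightarrow> ('i, 'p) name \<Rightarrow> bool" and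
  forces_mem :: "'p::order_top \<Rightarrow> ('i, 'p) name \<Rightarrow> ('i, 'p) name \<Rightarrow> bool"
where
  "forces_eq p a b \<longleftrightarrow>
     (\<forall>(c, s)\<in>elts a. \<forall>q. q \<le> p \<and> q \<le> s \<longrightarrow> forces_mem q c b) \<and>
     (\<forall>(d, s)\<in>elts b. \<forall>q. q \<le> p \<and> q \<le> s \<longrightarrow> forces_mem q d a)"
| "forces_mem p a b \<longleftrightarrow>
     (\<forall>q\<le>p. \<exists>r\<le>q. \<exists>(d, s)\<in>elts b. r \<le> s \<and> forces_eq r a d)"
  by pat_completeness auto

termination
proof -
  let ?R = "{(a, b :: ('i, 'p) name). a \<in> fst ` elts b}\<^sup>+"
  let ?m = "\<lambda>x :: ('p \<times> ('i, 'p) name \<times> ('i, 'p) name) + ('p \<times> ('i, 'p) name \<times> ('i, 'p) name).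
     case x of Inl (p, a, b) \<Rightarrow> {#a, b#} | Inr (p, a, b) \<Rightarrow> {#a, b#}"
  have wf: "wf (inv_image (mult ?R) ?m)"
    by (intro wf_inv_image wf_mult wf_trancl name_wf)
  have 1: "({#c, b#}, {#a, b#}) \<in> mult ?R" if "(c, s) \<in> elts a" for c a b :: "('i, 'p) name" and s
    using that
    by (intro one_step_implies_mult[of "{#a#}" "{#c#}" ?R "{#b#}", simplified add_mset_commute, simplified])
       (force intro: r_into_trancl)
  have 2: "({#d, a#}, {#a, b#}) \<in> mult ?R" "({#a, d#}, {#a, b#}) \<in> mult ?R"
    if "(d, s) \<in> elts b" for d a b :: "('i, 'p) name" and s
    using 1[OF that, of a] by (simp_all add: add_mset_commute)
  show ?thesis
    by (relation "inv_image (mult ?R) ?m", rule wf) (auto dest: 1 2)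
qed

text \<open>Formulas of the forcing language. Higher-order abstract syntax: the quantifier binds a
  function on names.\<close>

datatype ('i, 'p) fm =
    Eq "('i, 'p) name" "('i, 'p) name"  (infix \<open>\<^bold>=\<close> 60)
  | Mem "('i, 'p) name" "('i, 'p) name"  (infix \<open>\<^bold>\<in>\<close> 60)
  | Neg "('i, 'p) fm"  (\<open>\<^bold>\<not> _\<close> [50] 50)
  | Conj "('i, 'p) fm" "('i, 'p) fm"  (infixr \<open>\<^bold>\<and>\<close> 45)
  | Forall "('i, 'p) name \<Rightarrow> ('i, 'p) fm"  (binder \<open>\<^bold>\<forall>\<close> 30)

abbreviation Disj (infixr \<open>\<^bold>\<or>\<close> 40) where "\<phi> \<^bold>\<or> \<psi> \<equiv> \<^bold>\<not> (\<^bold>\<not> \<phi> \<^bold>\<and> \<^bold>\<not> \<psi>)"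
abbreviation Imp (infixr \<open>\<^bold>\<longrightarrow>\<close> 35) where "\<phi> \<^bold>\<longrightarrow> \<psi> \<equiv> \<^bold>\<not> (\<phi> \<^bold>\<and> \<^bold>\<not> \<psi>)"
abbreviation Iff (infix \<open>\<^bold>\<longleftrightarrow>\<close> 35) where "\<phi> \<^bold>\<longleftrightarrow> \<psi> \<equiv> (\<phi> \<^bold>\<longrightarrow> \<psi>) \<^bold>\<and> (\<psi> \<^bold>\<longrightarrow> \<phi>)"
abbreviation Exists (binder \<open>\<^bold>\<exists>\<close> 30) where "Exists \<phi> \<equiv> \<^bold>\<not> (\<^bold>\<forall>x. \<^bold>\<not> \<phi> x)"

primrec forces :: "'p::order_top \<Rightarrow> ('i, 'p) fm \<Rightarrow> bool"  (infix \<open>\<tturnstile>\<close> 28) where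
  "p \<tturnstile> a \<^bold>= b \<longleftrightarrow> forces_eq p a b"
| "p \<tturnstile> a \<^bold>\<in> b \<longleftrightarrow> forces_mem p a b"
| "p \<tturnstile> \<^bold>\<not> \<phi> \<longleftrightarrow> (\<forall>q\<le>p. \<not> (q \<tturnstile> \<phi>))"
| "p \<tturnstile> \<phi> \<^bold>\<and> \<psi> \<longleftrightarrow> (p \<tturnstile> \<phi>) \<and> (p \<tturnstile> \<psi>)"
| "p \<tturnstile> Forall \<phi> \<longleftrightarrow> (\<forall>x. p \<tturnstile> \<phi> x)"

section \<open>Cardinality in the forcing language\<close>

definition is_upair :: "('i, 'p) name \<Rightarrow> ('i, 'p) name \<Rightarrow> ('i, 'p) name \<Rightarrow> ('i, 'p) fm" where
  "is_upair z x y = (\<^bold>\<forall>w. w \<^bold>\<in> z \<^bold>\<longleftrightarrow> w \<^bold>= x \<^bold>\<or> w \<^bold>= y)"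

definition is_pair :: "('i, 'p) name \<Rightarrow> ('i, 'p) name \<Rightarrow> ('i, 'p) name \<Rightarrow> ('i, 'p) fm" where
  "is_pair z x y = (\<^bold>\<exists>u. \<^bold>\<exists>v. is_upair u x x \<^bold>\<and> is_upair v x y \<^bold>\<and> is_upair z u v)"

definition pair_in :: "('i, 'p) name \<Rightarrow> ('i, 'p) name \<Rightarrow> ('i, 'p) name \<Rightarrow> ('i, 'p) fm" where
  "pair_in x y f = (\<^bold>\<exists>z. is_pair z x y \<^bold>\<and> z \<^bold>\<in> f)"

definition is_bijection :: "('i, 'p) name \<Rightarrow> ('i, 'p) name \<Rightarrow> ('i, 'p) name \<Rightarrow> ('i, 'p) fm" where
  "is_bijection f A B =
     ((\<^bold>\<forall>z. z \<^bold>\<in> f \<^bold>\<longrightarrow> (\<^bold>\<exists>x. \<^bold>\<exists>y. x \<^bold>\<in> A \<^bold>\<and> y \<^bold>\<in> B \<^bold>\<and> is_pair z x y)) \<^bold>\<and>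
      (\<^bold>\<forall>x. x \<^bold>\<in> A \<^bold>\<longrightarrow> (\<^bold>\<exists>y. \<^bold>\<forall>v. pair_in x v f \<^bold>\<longleftrightarrow> v \<^bold>= y)) \<^bold>\<and>
      (\<^bold>\<forall>y. y \<^bold>\<in> B \<^bold>\<longrightarrow> (\<^bold>\<exists>x. \<^bold>\<forall>u. pair_in u y f \<^bold>\<longleftrightarrow> u \<^bold>= x)))"

definition same_cardinality :: "('i, 'p) name \<Rightarrow> ('i, 'p) name \<Rightarrow> ('i, 'p) fm" where
  "same_cardinality A B = (\<^bold>\<exists>f. is_bijection f A B)"

definition is_powerset :: "('i, 'p) name \<Rightarrow> ('i, 'p) name \<Rightarrow> ('i, 'p) fm" where
  "is_powerset P A = (\<^bold>\<forall>y. y \<^bold>\<in> P \<^bold>\<longleftrightarrow> (\<^bold>\<forall>x. x \<^bold>\<in> y \<^bold>\<longrightarrow> x \<^bold>\<in> A))"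

text \<open>\<open>continuum_eq_card A\<close> says $\mathfrak c = |A|$. The ordinal \<open>\<omega>\<close> is absolute, so in the
  extension it is the value of \<open>ordinal_check natLeq\<close>.\<close>

definition continuum_eq_card :: "('i, 'p::order_top) name \<Rightarrow> ('i, 'p) fm" where
  "continuum_eq_card A =
     (\<^bold>\<exists>P. is_powerset P (ordinal_check natLeq) \<^bold>\<and> same_cardinality P A)"

end

theory Submission
  imports Defs "HOL-Library.Countable"
begin

text \<open>For \<open>X\<close> in a weakly dominating family \<open>F\<close> of minimal size and a code \<open>\<alpha>\<close> of a real, call a tree
  thin if, for each \<open>i\<close>, between the levels \<open>\<mu>\<^sub>X(2\<^sup>i)\<close> and \<open>\<mu>\<^sub>X(2\<^sup>i\<^sup>+\<^sup>1)\<close> it splits only in the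
  interval whose index \<open>j < 2\<^sup>i\<close> is given by the first \<open>i\<close> bits of \<open>\<alpha>\<close>. Trees that are thin for the same
  \<open>X\<close> and different codes are incompatible. On the other hand, if \<open>Y\<close> is so sparse that every node of
  \<open>T\<close> at a level in \<open>Y\<close> has a splitting extension below the next level in \<open>Y\<close>, and \<open>X \<in> F\<close> is chosen for \<open>Y\<close>, then \<open>T\<close> can be
  thinned for \<open>X\<close> and any \<open>\<alpha>\<close>. So the generic filter determines a partial function \<open>H\<close> from \<open>F\<close> onto
  the reals of the ground model. By fusion, every real of the extension is read off continuously
  from the generic branch by a code in the ground model, so \<open>H\<close> gives a partial surjection from \<open>F\<close> to
  all reals. It becomes a bijection by taking least representatives and
  a Hilbert hotel argument with a copy of \<open>F \<times> \<omega>\<close> inside the ground model reals.\<close>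

section \<open>Basic properties of forcing\<close>

declare forces_eq.simps [simp del] forces_mem.simps [simp del]

lemma forces_eq_mono: "forces_eq p a b \<Longrightarrow> q \<le> p \<Longrightarrow> forces_eq q a b"
  unfolding forces_eq.simps[of p] forces_eq.simps[of q] by (blast intro: order_trans)

lemma forces_mem_mono: "forces_mem p a b \<Longrightarrow> q \<le> p \<Longrightarrow> forces_mem q a b"
  unfolding forces_mem.simps[of p] forces_mem.simps[of q] by (blast intro: order_trans)

lemma forces_mem_dense:
  assumes "\<And>q. q \<le> p \<Longrightarrow> \<exists>r\<le>q. forces_mem r a b"
  shows "forces_mem p a b"
  unfolding forces_mem.simps[of p]
proof (intro allI impI)
  fix q assume "q \<le> p"
  with assms obtain r where "r \<le> q" "forces_mem r a b" by blast
  then show "\<exists>r\<le>q. \<exists>(d, s)\<in>elts b. r \<le> s \<and> forces_eq r a d"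
    unfolding forces_mem.simps[of r] by (meson order.refl order.trans)
qed

lemma forces_eq_dense:
  assumes "\<And>q. q \<le> p \<Longrightarrow> \<exists>r\<le>q. forces_eq r a b"
  shows "forces_eq p a b"
proof -
  have *: "forces_mem q c b" if c: "(c, s) \<in> elts a" "q \<le> p" "q \<le> s"
    and dense: "\<And>q. q \<le> p \<Longrightarrow> \<exists>r\<le>q. forces_eq r a b" for a b c s q
  proof (rule forces_mem_dense)
    fix q' assume q': "q' \<le> q"
    with dense c obtain r where r: "r \<le> q'" "forces_eq r a b" by (meson order_trans)
    moreover have "r \<le> s" using r q' c by (meson order_trans)
    ultimately show "\<exists>r\<le>q'. forces_mem r c b"
      using c unfolding forces_eq.simps[of r] by blast
  qed
  have "forces_eq q a b = forces_eq q b a" for q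
    unfolding forces_eq.simps[of q] by auto
  with assms have "\<And>q. q \<le> p \<Longrightarrow> \<exists>r\<le>q. forces_eq r b a" by simp
  with assms show ?thesis
    unfolding forces_eq.simps[of p] by (auto intro: *)
qed

lemma forces_mono: "p \<tturnstile> \<phi> \<Longrightarrow> q \<le> p \<Longrightarrow> q \<tturnstile> \<phi>"
  by (induction \<phi> arbitrary: p q)
    (auto intro: forces_eq_mono forces_mem_mono order_trans rangeI)

lemma forces_dense: "(\<And>q. q \<le> p \<Longrightarrow> \<exists>r\<le>q. r \<tturnstile> \<phi>) \<Longrightarrow> p \<tturnstile> \<phi>"
proof (induction \<phi> arbitrary: p)
  case (Eq a b)
  then show ?case by (auto intro: forces_eq_dense)
next
  case (Mem a b)
  then show ?case by (auto intro: forces_mem_dense)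
next
  case (Neg \<phi>)
  show ?case
    unfolding forces.simps(3)
  proof (intro allI impI notI)
    fix q assume "q \<le> p" "q \<tturnstile> \<phi>"
    with Neg.prems obtain r where "r \<le> q" "r \<tturnstile> \<^bold>\<not> \<phi>" by blast
    with \<open>q \<tturnstile> \<phi>\<close> show False by (auto dest: forces_mono)
  qed
next
  case (Conj \<phi> \<psi>)
  show ?case
    using Conj.prems Conj.IH unfolding forces.simps(4) by meson
next
  case (Forall \<phi>)
  show ?case
    unfolding forces.simps(5)
    by (intro allI Forall.IH[OF rangeI]) (use Forall.prems in auto)
qed

lemma forces_Imp: "p \<tturnstile> \<phi> \<^bold>\<longrightarrow> \<psi> \<longleftrightarrow> (\<forall>q\<le>p. q \<tturnstile> \<phi> \<longrightarrow> q \<tturnstile> \<psi>)"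
proof
  assume L: "p \<tturnstile> \<phi> \<^bold>\<longrightarrow> \<psi>"
  show "\<forall>q\<le>p. q \<tturnstile> \<phi> \<longrightarrow> q \<tturnstile> \<psi>"
  proof (intro allI impI)
    fix q assume "q \<le> p" and q: "q \<tturnstile> \<phi>"
    show "q \<tturnstile> \<psi>"
    proof (rule forces_dense)
      fix r assume "r \<le> q"
      with q L \<open>q \<le> p\<close> show "\<exists>r'\<le>r. r' \<tturnstile> \<psi>"
        by simp (meson forces_mono order_trans)
    qed
  qed
next
  assume "\<forall>q\<le>p. q \<tturnstile> \<phi> \<longrightarrow> q \<tturnstile> \<psi>"
  then show "p \<tturnstile> \<phi> \<^bold>\<longrightarrow> \<psi>" by auto
qed

lemma forces_Iff: "p \<tturnstile> \<phi> \<^bold>\<longleftrightarrow> \<psi> \<longleftrightarrow> (\<forall>q\<le>p. q \<tturnstile> \<phi> \<longleftrightarrow> q \<tturnstile> \<psi>)"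
  unfolding forces.simps(4) forces_Imp by blast

lemma forces_Disj: "p \<tturnstile> \<phi> \<^bold>\<or> \<psi> \<longleftrightarrow> (\<forall>q\<le>p. \<exists>r\<le>q. (r \<tturnstile> \<phi>) \<or> (r \<tturnstile> \<psi>))"
  by simp (meson forces_mono order_refl order_trans)

lemma forces_Exists: "p \<tturnstile> Exists \<phi> \<longleftrightarrow> (\<forall>q\<le>p. \<exists>r\<le>q. \<exists>x. r \<tturnstile> \<phi> x)"
  by simp blast

lemma forces_ExistsI: "p \<tturnstile> \<phi> x \<Longrightarrow> p \<tturnstile> Exists \<phi>"
  unfolding forces_Exists by (meson forces_mono order_refl)

section \<open>Equality of names\<close>

lemma forces_eq_refl: "forces_eq p a a"
proof (induction a arbitrary: p rule: wf_induct_rule[OF name_wf])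
  case (1 a)
  have "forces_mem q c a" if "(c, s) \<in> elts a" "q \<le> s" for c s q
    unfolding forces_mem.simps[of q]
  proof (intro allI impI)
    fix r assume "r \<le> q"
    moreover from that have "(c, a) \<in> {(a, b). a \<in> fst ` elts b}" by force
    ultimately show "\<exists>r'\<le>r. \<exists>(d, s)\<in>elts a. r' \<le> s \<and> forces_eq r' c d"
      using 1 that by (intro exI[of _ r]) (auto intro!: bexI[of _ "(c, s)"])
  qed
  then show ?case unfolding forces_eq.simps[of p] by auto
qed

lemma forces_eq_sym: "forces_eq p a b \<Longrightarrow> forces_eq p b a"
  unfolding forces_eq.simps[of p] by auto

lemma forces_mem_elts: "(c, s) \<in> elts a \<Longrightarrow> p \<le> s \<Longrightarrow> forces_mem p c a"
  using forces_eq_refl[of p a] unfolding forces_eq.simps[of p] by auto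

lemma forces_memD:
  assumes "forces_mem p a b"
  obtains r d s where "r \<le> p" "(d, s) \<in> elts b" "r \<le> s" "forces_eq r a d"
  using assms unfolding forces_mem.simps[of p] by blast

lemma forces_memI:
  assumes "\<And>q. q \<le> p \<Longrightarrow> \<exists>r\<le>q. \<exists>d s. (d, s) \<in> elts b \<and> r \<le> s \<and> forces_eq r a d"
  shows "forces_mem p a b"
  unfolding forces_mem.simps[of p] using assms by (auto split: prod.split) blast

lemma forces_eq_elts: "forces_eq p a b \<Longrightarrow> (c, s) \<in> elts a \<Longrightarrow> p \<le> s \<Longrightarrow> forces_mem p c b"
  unfolding forces_eq.simps[of p] by auto

lemma forces_eq_trans: "forces_eq p a b \<Longrightarrow> forces_eq p b c \<Longrightarrow> forces_eq p a c"
proof (induction a arbitrary: p b c rule: wf_induct_rule[OF name_wf])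
  case (1 a)
  have IH: "forces_eq p x c" if "(x, s) \<in> elts a" "forces_eq p x b" "forces_eq p b c" for x s p b c
    using 1(1)[of x p b c] that by force
  show ?case
    unfolding forces_eq.simps[of p a c]
  proof (intro conjI ballI allI impI; clarify)
    fix x s q assume x: "(x, s) \<in> elts a" "q \<le> p" "q \<le> s"
    show "forces_mem q x c"
    proof (rule forces_memI)
      fix q' assume q': "q' \<le> q"
      then have "forces_mem q' x b"
        using x 1(2) by (meson forces_eq_elts forces_eq_mono order_trans)
      then obtain r d s where r: "r \<le> q'" "(d, s) \<in> elts b" "r \<le> s" "forces_eq r x d"
        by (rule forces_memD)
      have "r \<le> p" using r(1) q' x by (meson order_trans)
      then have "forces_mem r d c"
        using r 1(3) by (meson forces_eq_elts forces_eq_mono)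
      then obtain r' e s' where "r' \<le> r" "(e, s') \<in> elts c" "r' \<le> s'" "forces_eq r' d e"
        by (rule forces_memD)
      moreover from this r x have "forces_eq r' x e" by (meson IH forces_eq_mono)
      ultimately show "\<exists>r\<le>q'. \<exists>d s. (d, s) \<in> elts c \<and> r \<le> s \<and> forces_eq r x d"
        using r by (meson order_trans)
    qed
  next
    fix e s q assume e: "(e, s) \<in> elts c" "q \<le> p" "q \<le> s"
    show "forces_mem q e a"
    proof (rule forces_memI)
      fix q' assume q': "q' \<le> q"
      then have "forces_mem q' e b"
        using e 1(3) by (meson forces_eq_elts forces_eq_mono forces_eq_sym order_trans)
      then obtain r d s where r: "r \<le> q'" "(d, s) \<in> elts b" "r \<le> s" "forces_eq r e d"
        by (rule forces_memD)
      have "r \<le> p" using r(1) q' e by (meson order_trans)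
      then have "forces_mem r d a"
        using r 1(2) by (meson forces_eq_elts forces_eq_mono forces_eq_sym)
      then obtain r' x s' where "r' \<le> r" "(x, s') \<in> elts a" "r' \<le> s'" "forces_eq r' d x"
        by (rule forces_memD)
      moreover from this r have "forces_eq r' e x"
        by (meson IH forces_eq_mono forces_eq_sym)
      ultimately show "\<exists>r\<le>q'. \<exists>d s. (d, s) \<in> elts a \<and> r \<le> s \<and> forces_eq r e d"
        using r by (meson order_trans)
    qed
  qed
qed

lemma forces_mem_cong_left:
  assumes "forces_eq p a b" "forces_mem p a c"
  shows "forces_mem p b c"
proof (rule forces_memI)
  fix q assume "q \<le> p"
  with assms(2) have "forces_mem q a c" by (rule forces_mem_mono)
  then obtain r d s where r: "r \<le> q" "(d, s) \<in> elts c" "r \<le> s" "forces_eq r a d"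
    by (rule forces_memD)
  then have "forces_eq r b d"
    using assms(1) \<open>q \<le> p\<close> by (meson forces_eq_mono forces_eq_sym forces_eq_trans order_trans)
  with r show "\<exists>r\<le>q. \<exists>d s. (d, s) \<in> elts c \<and> r \<le> s \<and> forces_eq r b d" by blast
qed

lemma forces_mem_cong_right:
  assumes "forces_eq p b c" "forces_mem p a b"
  shows "forces_mem p a c"
proof (rule forces_mem_dense)
  fix q assume "q \<le> p"
  with assms(2) have "forces_mem q a b" by (rule forces_mem_mono)
  then obtain r d s where r: "r \<le> q" "(d, s) \<in> elts b" "r \<le> s" "forces_eq r a d"
    by (rule forces_memD)
  then have "forces_mem r d c"
    using assms(1) \<open>q \<le> p\<close> by (meson forces_eq_elts forces_eq_mono order_trans)
  with r show "\<exists>r\<le>q. forces_mem r a c"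
    by (meson forces_eq_sym forces_mem_cong_left)
qed

lemma forces_extensionality:
  assumes "\<And>w q. q \<le> p \<Longrightarrow> forces_mem q w a \<longleftrightarrow> forces_mem q w b"
  shows "forces_eq p a b"
  unfolding forces_eq.simps[of p] using assms by (auto simp: forces_mem_elts dest: forces_mem_elts)

lemma not_forces_mem_self: "\<not> forces_mem p a a"
proof (induction a arbitrary: p rule: wf_induct_rule[OF name_wf])
  case (1 a)
  show ?case
  proof
    assume "forces_mem p a a"
    then obtain r d s where r: "r \<le> p" "(d, s) \<in> elts a" "r \<le> s" "forces_eq r a d"
      by (rule forces_memD)
    then have "forces_mem r d d"
      by (meson forces_mem_cong_right forces_mem_elts)
    with 1[of d r] r show False by force
  qed
qed

lemma segment_check_inject:
  assumes r: "Well_order r" "|Field r| \<le>o |UNIV :: 'i set|"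
    and x: "x \<in> Field r" and y: "y \<in> Field r"
    and eq: "forces_eq p (segment_check r x :: ('i, 'p::order_top) name) (segment_check r y)"
  shows "x = y"
proof (rule ccontr)
  assume "x \<noteq> y"
  have False if xy: "x \<in> underS r y"
    and eq: "forces_eq p (segment_check r x :: ('i, 'p::order_top) name) (segment_check r y)" for x y
  proof -
    have "forces_mem p (segment_check r x :: ('i, 'p) name) (segment_check r y)"
      using xy by (intro forces_mem_elts[where s = top]) (auto simp: elts_segment_check[OF r])
    with eq show False
      by (meson forces_eq_sym forces_mem_cong_right not_forces_mem_self)
  qed
  moreover have "x \<in> underS r y \<or> y \<in> underS r x"
    using r(1) x y \<open>x \<noteq> y\<close> unfolding well_order_on_def linear_order_on_def total_on_def underS_def
    by blast
  ultimately show False using eq forces_eq_sym by blast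
qed

section \<open>Ordered pairs and bijections\<close>

definition upair :: "('i, 'p::order_top) name \<Rightarrow> ('i, 'p) name \<Rightarrow> ('i, 'p) name" where
  "upair a b = name_of {(a, top), (b, top)}"

definition opair :: "('i, 'p::order_top) name \<Rightarrow> ('i, 'p) name \<Rightarrow> ('i, 'p) name" where
  "opair a b = upair (upair a a) (upair a b)"

context
  assumes inf: "infinite (UNIV :: 'i set)"
begin

lemma elts_upair: "elts (upair a b :: ('i, 'p::order_top) name) = {(a, top), (b, top)}"
  unfolding upair_def
  by (rule elts_name_of)
    (metis inf card_of_Well_order card_of_ordLeq_finite finite.emptyI finite.insertI ordLeq_total)

lemma forces_mem_upair:
  "forces_mem p w (upair a b :: ('i, 'p::order_top) name) \<longleftrightarrow>
    (\<forall>q\<le>p. \<exists>r\<le>q. forces_eq r w a \<or> forces_eq r w b)"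
  unfolding forces_mem.simps[of p] elts_upair by auto

lemma forces_is_upair:
  "p \<tturnstile> is_upair z x y \<longleftrightarrow> forces_eq p z (upair x y :: ('i, 'p::order_top) name)"
proof -
  have "p \<tturnstile> is_upair z x y \<longleftrightarrow>
    (\<forall>w. \<forall>q\<le>p. forces_mem q w z \<longleftrightarrow> forces_mem q w (upair x y))"
    unfolding is_upair_def forces.simps(5) forces_Iff forces_Disj forces.simps(1,2)
      forces_mem_upair by blast
  also have "\<dots> \<longleftrightarrow> forces_eq p z (upair x y)"
    by (meson forces_extensionality forces_eq_mono forces_mem_cong_right forces_eq_sym)
  finally show ?thesis .
qed

lemma upair_cong:
  assumes "forces_eq p a a'" "forces_eq p b b'"
  shows "forces_eq p (upair a b) (upair a' b' :: ('i, 'p::order_top) name)"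
proof (rule forces_extensionality)
  fix w q assume "q \<le> p"
  then show "forces_mem q w (upair a b) \<longleftrightarrow> forces_mem q w (upair a' b' :: ('i, 'p) name)"
    unfolding forces_mem_upair using assms
    by (meson forces_eq_mono forces_eq_trans forces_eq_sym order_trans)
qed

lemma opair_cong:
  assumes "forces_eq p a a'" "forces_eq p b b'"
  shows "forces_eq p (opair a b) (opair a' b' :: ('i, 'p::order_top) name)"
  unfolding opair_def by (intro upair_cong assms)

lemma forces_is_pair:
  "p \<tturnstile> is_pair z x y \<longleftrightarrow> forces_eq p z (opair x y :: ('i, 'p::order_top) name)"
proof
  assume L: "p \<tturnstile> is_pair z x y"
  show "forces_eq p z (opair x y)"
  proof (rule forces_eq_dense)
    fix q assume "q \<le> p"
    with L obtain r u where r: "r \<le> q"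
      "r \<tturnstile> (\<^bold>\<exists>v. is_upair u x x \<^bold>\<and> is_upair v x y \<^bold>\<and> is_upair z u v)"
      unfolding is_pair_def forces_Exists[of p] by blast
    then obtain r' v where "r' \<le> r" "r' \<tturnstile> is_upair u x x" "r' \<tturnstile> is_upair v x y" "r' \<tturnstile> is_upair z u v"
      unfolding forces_Exists[of r] forces.simps(4) by blast
    moreover from this have "forces_eq r' z (opair x y)"
      unfolding forces_is_upair opair_def by (meson forces_eq_trans upair_cong)
    ultimately show "\<exists>r\<le>q. forces_eq r z (opair x y)" using r by (meson order_trans)
  qed
next
  assume "forces_eq p z (opair x y)"
  then show "p \<tturnstile> is_pair z x y"
    unfolding is_pair_def
    by (intro forces_ExistsI[where x = "upair x x"] forces_ExistsI[where x = "upair x y"])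
      (simp add: forces_is_upair forces_eq_refl opair_def)
qed

lemma forces_eq_upairD:
  assumes "forces_eq p (upair a b) (upair c d :: ('i, 'p::order_top) name)"
  obtains r where "r \<le> p"
    "forces_eq r a c \<and> forces_eq r b d \<or> forces_eq r a d \<and> forces_eq r b c"
proof -
  have left: "\<exists>r\<le>p. forces_eq r a c \<or> forces_eq r a d"
    if "forces_eq p (upair a b) (upair c d)" for p :: 'p and a b c d :: "('i, 'p) name"
    using forces_eq_elts[OF that, of a top] unfolding elts_upair forces_mem_upair by auto
  have right: "\<exists>r\<le>p. forces_eq r b c \<or> forces_eq r b d"
    if "forces_eq p (upair a b) (upair c d)" for p :: 'p and a b c d :: "('i, 'p) name"
    using forces_eq_elts[OF that, of b top] unfolding elts_upair forces_mem_upair by auto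
  obtain r1 where r1: "r1 \<le> p" "forces_eq r1 a c \<or> forces_eq r1 a d"
    using left[OF assms] by blast
  obtain r2 where r2: "r2 \<le> r1" "forces_eq r2 b c \<or> forces_eq r2 b d"
    using right[OF forces_eq_mono[OF assms r1(1)]] by blast
  have r2p: "r2 \<le> p" using r1 r2 by (meson order_trans)
  obtain r3 where r3: "r3 \<le> r2" "forces_eq r3 c a \<or> forces_eq r3 c b"
    using left[OF forces_eq_sym[OF forces_eq_mono[OF assms r2p]]] by blast
  have r3p: "r3 \<le> p" using r2p r3 by (meson order_trans)
  obtain r4 where r4: "r4 \<le> r3" "forces_eq r4 d a \<or> forces_eq r4 d b"
    using right[OF forces_eq_sym[OF forces_eq_mono[OF assms r3p]]] by blast
  have "forces_eq r4 a c \<or> forces_eq r4 a d" "forces_eq r4 b c \<or> forces_eq r4 b d"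
    "forces_eq r4 c a \<or> forces_eq r4 c b"
    using r1 r2 r3 r4 by (meson forces_eq_mono order_trans)+
  with r4 have "forces_eq r4 a c \<and> forces_eq r4 b d \<or> forces_eq r4 a d \<and> forces_eq r4 b c"
    by (meson forces_eq_sym forces_eq_trans)
  moreover have "r4 \<le> p" using r4 r3p by (meson order_trans)
  ultimately show ?thesis by (rule that[rotated])
qed

lemma forces_eq_opair:
  "forces_eq p (opair a b) (opair c d :: ('i, 'p::order_top) name) \<longleftrightarrow>
    forces_eq p a c \<and> forces_eq p b d"
proof
  assume L: "forces_eq p (opair a b) (opair c d)"
  have "\<exists>r\<le>q. forces_eq r a c \<and> forces_eq r b d" if "q \<le> p" for q
  proof -
    from forces_eq_mono[OF L that] obtain r where r: "r \<le> q"
      "forces_eq r (upair a a) (upair c c) \<and> forces_eq r (upair a b) (upair c d) \<or>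
       forces_eq r (upair a a) (upair c d) \<and> forces_eq r (upair a b) (upair c c)"
      unfolding opair_def by (rule forces_eq_upairD)
    obtain e where e: "forces_eq r (upair a a) (upair c e)"
      "forces_eq r (upair a b) (upair c c) \<and> e = d \<or> forces_eq r (upair a b) (upair c d) \<and> e = c"
      using r by blast
    obtain r1 where r1: "r1 \<le> r" "forces_eq r1 a c" "forces_eq r1 a e"
      using forces_eq_upairD[OF e(1)] by metis
    have "r1 \<le> q" using r r1 by (meson order_trans)
    from e(2) show ?thesis
    proof
      assume *: "forces_eq r (upair a b) (upair c c) \<and> e = d"
      then obtain r2 where r2: "r2 \<le> r1" "forces_eq r2 b c"
        using r1 forces_eq_upairD forces_eq_mono by metis
      have "forces_eq r2 a c" "forces_eq r2 a d"
        using r1 r2 * forces_eq_mono by blast+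
      then have "forces_eq r2 b d"
        using r2 by (meson forces_eq_sym forces_eq_trans)
      with \<open>forces_eq r2 a c\<close> r2 \<open>r1 \<le> q\<close> show ?thesis by (meson order_trans)
    next
      assume *: "forces_eq r (upair a b) (upair c d) \<and> e = c"
      then have "forces_eq r1 (upair a b) (upair c d)" using r1 forces_eq_mono by blast
      then obtain r2 where r2: "r2 \<le> r1"
          "forces_eq r2 a c \<and> forces_eq r2 b d \<or> forces_eq r2 a d \<and> forces_eq r2 b c"
        by (rule forces_eq_upairD)
      have ac: "forces_eq r2 a c" using r1 r2 forces_eq_mono by blast
      with r2 have "forces_eq r2 b d" by (meson forces_eq_sym forces_eq_trans)
      with ac r2 \<open>r1 \<le> q\<close> show ?thesis by (meson order_trans)
    qed
  qed
  then show "forces_eq p a c \<and> forces_eq p b d"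
    by (meson forces_eq_dense)
qed (simp add: opair_cong)

lemma forces_pair_in:
  "p \<tturnstile> pair_in x y f \<longleftrightarrow> forces_mem p (opair x y :: ('i, 'p::order_top) name) f"
proof
  assume L: "p \<tturnstile> pair_in x y f"
  show "forces_mem p (opair x y) f"
  proof (rule forces_mem_dense)
    fix q assume "q \<le> p"
    with L obtain r z where "r \<le> q" "r \<tturnstile> is_pair z x y" "r \<tturnstile> z \<^bold>\<in> f"
      unfolding pair_in_def forces_Exists[of p] forces.simps(4) by blast
    then show "\<exists>r\<le>q. forces_mem r (opair x y) f"
      unfolding forces_is_pair by (auto intro: forces_mem_cong_left)
  qed
next
  assume "forces_mem p (opair x y) f"
  then show "p \<tturnstile> pair_in x y f"
    unfolding pair_in_def by (intro forces_ExistsI[where x = "opair x y"])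
      (simp add: forces_is_pair forces_eq_refl)
qed

lemma forces_is_bijection:
  fixes A B f :: "('i, 'p::order_top) name"
  assumes A: "elts A = (\<lambda>a. (a, top)) ` AA" and B: "elts B = (\<lambda>b. (b, top)) ` BB"
    and f: "elts f = {(opair a b, s) |a b s. (a, b, s) \<in> R}"
    and R: "\<And>a b s. (a, b, s) \<in> R \<Longrightarrow> a \<in> AA \<and> b \<in> BB"
    and total: "\<And>a p. a \<in> AA \<Longrightarrow> \<exists>q\<le>p. \<exists>a' b s. (a', b, s) \<in> R \<and> q \<le> s \<and> forces_eq q a a'"
    and onto: "\<And>b p. b \<in> BB \<Longrightarrow> \<exists>q\<le>p. \<exists>a b' s. (a, b', s) \<in> R \<and> q \<le> s \<and> forces_eq q b b'"
    and functional: "\<And>a b s a' b' s' q. (a, b, s) \<in> R \<Longrightarrow> (a', b', s') \<in> R \<Longrightarrow>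
      q \<le> s \<Longrightarrow> q \<le> s' \<Longrightarrow> forces_eq q a a' \<longleftrightarrow> forces_eq q b b'"
  shows "p \<tturnstile> is_bijection f A B"
proof -
  have mem_fD: "\<exists>r\<le>p. \<exists>a b s. (a, b, s) \<in> R \<and> r \<le> s \<and> forces_eq r x a \<and> forces_eq r y b"
    if "forces_mem p (opair x y) f" for p x y
  proof -
    from that obtain r d s where r: "r \<le> p" "(d, s) \<in> elts f" "r \<le> s" "forces_eq r (opair x y) d"
      by (rule forces_memD)
    from r(2) obtain a b where "(a, b, s) \<in> R" "d = opair a b" unfolding f by blast
    with r show ?thesis using forces_eq_opair by blast
  qed
  have mem_fI: "forces_mem p (opair x y) f"
    if "(a, b, s) \<in> R" "p \<le> s" "forces_eq p x a" "forces_eq p y b" for p x y a b s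
  proof -
    have "forces_mem p (opair a b) f"
      by (rule forces_mem_elts[where s = s]) (use that f in auto)
    then show ?thesis
      using that by (meson forces_eq_sym forces_mem_cong_left opair_cong)
  qed
  have pairs: "p \<tturnstile> (\<^bold>\<forall>z. z \<^bold>\<in> f \<^bold>\<longrightarrow> (\<^bold>\<exists>x. \<^bold>\<exists>y. x \<^bold>\<in> A \<^bold>\<and> y \<^bold>\<in> B \<^bold>\<and> is_pair z x y))"
    unfolding forces.simps(5) forces_Imp
  proof (intro allI impI)
    fix z q assume "q \<le> p" and z: "q \<tturnstile> z \<^bold>\<in> f"
    show "q \<tturnstile> (\<^bold>\<exists>x. \<^bold>\<exists>y. x \<^bold>\<in> A \<^bold>\<and> y \<^bold>\<in> B \<^bold>\<and> is_pair z x y)"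
    proof (rule forces_dense)
      fix q' assume "q' \<le> q"
      with z have "forces_mem q' z f" using forces_mem_mono by auto
      then obtain r d s where r: "r \<le> q'" "(d, s) \<in> elts f" "r \<le> s" "forces_eq r z d"
        by (rule forces_memD)
      then obtain a b where ab: "(a, b, s) \<in> R" "d = opair a b" unfolding f by blast
      with R[of a b s] have "forces_mem r a A" "forces_mem r b B"
        by (auto intro!: forces_mem_elts[where s = top] simp: A B)
      then have "r \<tturnstile> (\<^bold>\<exists>x. \<^bold>\<exists>y. x \<^bold>\<in> A \<^bold>\<and> y \<^bold>\<in> B \<^bold>\<and> is_pair z x y)"
        using r ab by (intro forces_ExistsI[where x = a] forces_ExistsI[where x = b])
          (simp add: forces_is_pair)
      with r show "\<exists>r\<le>q'. r \<tturnstile> (\<^bold>\<exists>x. \<^bold>\<exists>y. x \<^bold>\<in> A \<^bold>\<and> y \<^bold>\<in> B \<^bold>\<and> is_pair z x y)" by blast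
    qed
  qed
  have left: "p \<tturnstile> (\<^bold>\<forall>x. x \<^bold>\<in> A \<^bold>\<longrightarrow> (\<^bold>\<exists>y. \<^bold>\<forall>v. pair_in x v f \<^bold>\<longleftrightarrow> v \<^bold>= y))"
    unfolding forces.simps(5) forces_Imp
  proof (intro allI impI)
    fix x q assume "q \<le> p" and x: "q \<tturnstile> x \<^bold>\<in> A"
    show "q \<tturnstile> (\<^bold>\<exists>y. \<^bold>\<forall>v. pair_in x v f \<^bold>\<longleftrightarrow> v \<^bold>= y)"
    proof (rule forces_dense)
      fix q' assume "q' \<le> q"
      with x have "forces_mem q' x A" using forces_mem_mono by auto
      then obtain r d s where r: "r \<le> q'" "(d, s) \<in> elts A" "r \<le> s" "forces_eq r x d"
        by (rule forces_memD)
      then obtain r' a b s' where r': "r' \<le> r" "(a, b, s') \<in> R" "r' \<le> s'" "forces_eq r' d a"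
        using total[of d r] unfolding A by blast
      have xa: "forces_eq r' x a" using r r' by (meson forces_eq_mono forces_eq_trans)
      have "r' \<tturnstile> (\<^bold>\<forall>v. pair_in x v f \<^bold>\<longleftrightarrow> v \<^bold>= b)"
        unfolding forces.simps(5) forces_Iff forces_pair_in forces.simps(1)
      proof (intro allI impI iffI)
        fix v t assume t: "t \<le> r'" "forces_mem t (opair x v) f"
        show "forces_eq t v b"
        proof (rule forces_eq_dense)
          fix t' assume "t' \<le> t"
          with t obtain u a2 b2 s2 where u: "u \<le> t'" "(a2, b2, s2) \<in> R" "u \<le> s2"
              "forces_eq u x a2" "forces_eq u v b2"
            using mem_fD forces_mem_mono by meson
          have "u \<le> r'" using u t \<open>t' \<le> t\<close> by (meson order_trans)
          with u xa have "forces_eq u a2 a" by (meson forces_eq_mono forces_eq_sym forces_eq_trans)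
          with functional[OF u(2) r'(2) u(3)] \<open>u \<le> r'\<close> r' have "forces_eq u b2 b"
            by (meson order_trans)
          with u show "\<exists>u\<le>t'. forces_eq u v b" by (meson forces_eq_trans)
        qed
      next
        fix v t assume "t \<le> r'" "forces_eq t v b"
        then show "forces_mem t (opair x v) f"
          using r' xa by (meson mem_fI forces_eq_mono order_trans)
      qed
      then have "r' \<tturnstile> (\<^bold>\<exists>y. \<^bold>\<forall>v. pair_in x v f \<^bold>\<longleftrightarrow> v \<^bold>= y)"
        by (rule forces_ExistsI)
      moreover have "r' \<le> q'" using r r' by (meson order_trans)
      ultimately show "\<exists>r\<le>q'. r \<tturnstile> (\<^bold>\<exists>y. \<^bold>\<forall>v. pair_in x v f \<^bold>\<longleftrightarrow> v \<^bold>= y)" by blast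
    qed
  qed
  have right: "p \<tturnstile> (\<^bold>\<forall>y. y \<^bold>\<in> B \<^bold>\<longrightarrow> (\<^bold>\<exists>x. \<^bold>\<forall>u. pair_in u y f \<^bold>\<longleftrightarrow> u \<^bold>= x))"
    unfolding forces.simps(5) forces_Imp
  proof (intro allI impI)
    fix x q assume "q \<le> p" and x: "q \<tturnstile> x \<^bold>\<in> B"
    show "q \<tturnstile> (\<^bold>\<exists>y. \<^bold>\<forall>v. pair_in v x f \<^bold>\<longleftrightarrow> v \<^bold>= y)"
    proof (rule forces_dense)
      fix q' assume "q' \<le> q"
      with x have "forces_mem q' x B" using forces_mem_mono by auto
      then obtain r d s where r: "r \<le> q'" "(d, s) \<in> elts B" "r \<le> s" "forces_eq r x d"
        by (rule forces_memD)
      then obtain r' a b s' where r': "r' \<le> r" "(b, a, s') \<in> R" "r' \<le> s'" "forces_eq r' d a"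
        using onto[of d r] unfolding B by blast
      have xa: "forces_eq r' x a" using r r' by (meson forces_eq_mono forces_eq_trans)
      have "r' \<tturnstile> (\<^bold>\<forall>v. pair_in v x f \<^bold>\<longleftrightarrow> v \<^bold>= b)"
        unfolding forces.simps(5) forces_Iff forces_pair_in forces.simps(1)
      proof (intro allI impI iffI)
        fix v t assume t: "t \<le> r'" "forces_mem t (opair v x) f"
        show "forces_eq t v b"
        proof (rule forces_eq_dense)
          fix t' assume "t' \<le> t"
          with t obtain u a2 b2 s2 where u: "u \<le> t'" "(b2, a2, s2) \<in> R" "u \<le> s2"
              "forces_eq u x a2" "forces_eq u v b2"
            using mem_fD forces_mem_mono by meson
          have "u \<le> r'" using u t \<open>t' \<le> t\<close> by (meson order_trans)
          with u xa have "forces_eq u a2 a" by (meson forces_eq_mono forces_eq_sym forces_eq_trans)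
          with functional[OF u(2) r'(2) u(3)] \<open>u \<le> r'\<close> r' have "forces_eq u b2 b"
            by (meson order_trans)
          with u show "\<exists>u\<le>t'. forces_eq u v b" by (meson forces_eq_trans)
        qed
      next
        fix v t assume "t \<le> r'" "forces_eq t v b"
        then show "forces_mem t (opair v x) f"
          using r' xa by (meson mem_fI forces_eq_mono order_trans)
      qed
      then have "r' \<tturnstile> (\<^bold>\<exists>y. \<^bold>\<forall>v. pair_in v x f \<^bold>\<longleftrightarrow> v \<^bold>= y)"
        by (rule forces_ExistsI)
      moreover have "r' \<le> q'" using r r' by (meson order_trans)
      ultimately show "\<exists>r\<le>q'. r \<tturnstile> (\<^bold>\<exists>y. \<^bold>\<forall>v. pair_in v x f \<^bold>\<longleftrightarrow> v \<^bold>= y)" by blast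
    qed
  qed
  from pairs left right show ?thesis
    unfolding is_bijection_def forces.simps(4) by blast
qed

end

section \<open>Perfect trees\<close>

lemma perfect_tree: "perfect_tree (tree T)"
  using tree[of T] by simp

lemma tree_nonempty: "tree T \<noteq> {}"
  using perfect_tree unfolding perfect_tree_def by blast

lemma tree_prefix: "t \<in> tree T \<Longrightarrow> prefix s t \<Longrightarrow> s \<in> tree T"
  using perfect_tree unfolding perfect_tree_def by blast

lemma Nil_in_tree: "[] \<in> tree T"
  using tree_nonempty[of T] tree_prefix by auto

definition splits :: "bool list set \<Rightarrow> bool list \<Rightarrow> bool" where
  "splits T t \<longleftrightarrow> t @ [False] \<in> T \<and> t @ [True] \<in> T"

lemma splitsD: "splits T t \<Longrightarrow> t @ [b] \<in> T"
  by (cases b) (auto simp: splits_def)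

lemma splits_mono: "splits S t \<Longrightarrow> S \<subseteq> T \<Longrightarrow> splits T t"
  by (auto simp: splits_def)

lemma splits_in_tree: "splits (tree T) t \<Longrightarrow> t \<in> tree T"
  by (auto simp: splits_def intro: tree_prefix)

lemma tree_splits: "s \<in> tree T \<Longrightarrow> \<exists>t. prefix s t \<and> splits (tree T) t"
  using perfect_tree[of T] unfolding perfect_tree_def splits_def by blast

lemma tree_splits_long:
  assumes "s \<in> tree T"
  shows "\<exists>t. prefix s t \<and> n \<le> length t \<and> splits (tree T) t"
proof (induction n)
  case 0
  show ?case using tree_splits[OF assms] by simp
next
  case (Suc n)
  then obtain t where t: "prefix s t" "n \<le> length t" "splits (tree T) t" by blast
  then obtain t' where "prefix (t @ [True]) t'" "splits (tree T) t'"
    using tree_splits splitsD by blast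
  moreover from this have "prefix s t'" using t by (meson append_prefixD prefix_order.trans)
  moreover have "Suc n \<le> length t'" using prefix_length_le[OF \<open>prefix (t @ [True]) t'\<close>] t by simp
  ultimately show ?case by blast
qed

lemma tree_extend:
  assumes "s \<in> tree T" "length s \<le> n"
  obtains t where "t \<in> tree T" "prefix s t" "length t = n"
proof -
  from assms(1) obtain u where u: "prefix s u" "n \<le> length u" "splits (tree T) u"
    using tree_splits_long by blast
  show ?thesis
  proof
    show "take n u \<in> tree T" using u by (meson splits_in_tree take_is_prefix tree_prefix)
    show "prefix s (take n u)"
      using u assms(2) by (metis length_take min_absorb2 prefix_length_prefix take_is_prefix)
    show "length (take n u) = n" using u by simp
  qed
qed

lemma perfect_treeI:
  assumes "T \<noteq> {}" "\<And>s t. t \<in> T \<Longrightarrow> prefix s t \<Longrightarrow> s \<in> T"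
    "\<And>s. s \<in> T \<Longrightarrow> \<exists>t. prefix s t \<and> splits T t"
  shows "perfect_tree T"
  unfolding perfect_tree_def using assms unfolding splits_def by blast

definition restrict_tree :: "sacks \<Rightarrow> bool list \<Rightarrow> sacks" where
  "restrict_tree T t = Sacks {s \<in> tree T. prefix s t \<or> prefix t s}"

lemma tree_restrict:
  assumes t: "t \<in> tree T"
  shows "tree (restrict_tree T t) = {s \<in> tree T. prefix s t \<or> prefix t s}"
  unfolding restrict_tree_def
proof (rule Sacks_inverse, rule CollectI, rule perfect_treeI)
  show "{s \<in> tree T. prefix s t \<or> prefix t s} \<noteq> {}" using t by auto
next
  fix s u assume "u \<in> {s \<in> tree T. prefix s t \<or> prefix t s}" "prefix s u"
  then show "s \<in> {s \<in> tree T. prefix s t \<or> prefix t s}"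
    using prefix_same_cases tree_prefix by (auto intro: prefix_order.trans)
next
  fix s assume s: "s \<in> {s \<in> tree T. prefix s t \<or> prefix t s}"
  define u where "u = (if prefix t s then s else t)"
  have u: "prefix s u" "prefix t u" "u \<in> tree T" using s t by (auto simp: u_def)
  from tree_splits[OF u(3)] obtain v where v: "prefix u v" "splits (tree T) v" by blast
  then have "prefix t v" "prefix s v" using u by (auto intro: prefix_order.trans)
  with v show "\<exists>v. prefix s v \<and> splits {s \<in> tree T. prefix s t \<or> prefix t s} v"
    by (auto simp: splits_def)
qed

lemma restrict_tree_le: "t \<in> tree T \<Longrightarrow> restrict_tree T t \<le> T"
  by (auto simp: less_eq_sacks_def tree_restrict)

lemma restrict_tree_mono: "S \<le> T \<Longrightarrow> t \<in> tree S \<Longrightarrow> restrict_tree S t \<le> restrict_tree T t"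
  by (subst less_eq_sacks_def, subst (1 2) tree_restrict) (auto simp: less_eq_sacks_def)

lemma le_restrict_tree:
  assumes "q \<le> T" "q \<le> restrict_tree top t" "t \<in> tree T"
  shows "q \<le> restrict_tree T t"
proof -
  have "t \<in> tree top" using assms(3) top_greatest[of T] by (auto simp: less_eq_sacks_def)
  with assms show ?thesis by (auto simp: less_eq_sacks_def tree_restrict)
qed

lemma splits_comparable:
  assumes "splits T v" "\<And>s. s \<in> T \<Longrightarrow> prefix s u \<or> prefix u s"
  shows "prefix u v"
proof (rule ccontr)
  assume no: "\<not> prefix u v"
  have "prefix (v @ [b]) u" for b
    using assms(2)[OF splitsD[OF assms(1)], of b] no by (auto simp: prefix_snoc)
  from this[of True] this[of False] show False by (auto simp: prefix_def)
qed

section \<open>Fusion\<close>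

definition splitting_node :: "sacks \<Rightarrow> bool list" where
  "splitting_node T = (SOME t. splits (tree T) t)"

lemma splits_splitting_node: "splits (tree T) (splitting_node T)"
  unfolding splitting_node_def using tree_splits[OF Nil_in_tree] by (metis someI_ex)

lemma fusion:
  fixes D :: "nat \<Rightarrow> sacks set"
  assumes down: "\<And>n p q. p \<in> D n \<Longrightarrow> q \<le> p \<Longrightarrow> q \<in> D n"
    and dense: "\<And>n p. \<exists>q\<le>p. q \<in> D n"
  obtains S where "S \<le> T"
    "\<And>n. \<exists>m. \<forall>t\<in>tree S. length t = m \<longrightarrow> restrict_tree S t \<in> D n"
proof -
  define next_tree where "next_tree n p b =
    (SOME q. q \<le> restrict_tree p (splitting_node p @ [b]) \<and> q \<in> D n)" for n p b
  have next_tree: "next_tree n p b \<le> restrict_tree p (splitting_node p @ [b])"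
    "next_tree n p b \<in> D n" for n p b
    using someI_ex[OF dense[of "restrict_tree p (splitting_node p @ [b])" n, simplified]]
    unfolding next_tree_def by auto
  define W where "W = rec_list T (\<lambda>b s p. next_tree (length s) p b)"
  have W: "W [] = T" "W (b # s) = next_tree (length s) (W s) b" for b s
    by (simp_all add: W_def)
  define \<sigma> where "\<sigma> s = splitting_node (W s)" for s
  have \<sigma>_W: "splits (tree (W s)) (\<sigma> s)" for s
    by (simp add: \<sigma>_def splits_splitting_node)
  have W_restrict: "W (b # s) \<le> restrict_tree (W s) (\<sigma> s @ [b])" for b s
    unfolding W \<sigma>_def by (rule next_tree)
  have in_W: "\<sigma> s @ [b] \<in> tree (W s)" for s b
    by (rule splitsD[OF \<sigma>_W])
  have W_step: "W (b # s) \<le> W s" for b s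
    using W_restrict restrict_tree_le[OF in_W] by (rule order_trans)
  have W_comparable: "prefix x (\<sigma> s @ [b]) \<or> prefix (\<sigma> s @ [b]) x" if "x \<in> tree (W (b # s))" for x b s
    using W_restrict[of b s] that by (auto simp: less_eq_sacks_def tree_restrict[OF in_W])
  have \<sigma>_step: "prefix (\<sigma> s @ [b]) (\<sigma> (b # s))" for b s
    by (rule splits_comparable[OF \<sigma>_W W_comparable])
  have \<sigma>_step': "prefix (\<sigma> s) (\<sigma> (b # s))" for b s
    by (rule append_prefixD[OF \<sigma>_step])
  have W_append: "W (s' @ s) \<le> W s" for s s'
    by (induction s') (auto intro: order_trans[OF W_step])
  have \<sigma>_append: "prefix (\<sigma> s) (\<sigma> (s' @ s))" for s s'
    by (induction s') (auto intro: prefix_order.trans[OF _ \<sigma>_step'])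
  have \<sigma>_inject: "s = s'" if "length s = length s'" "prefix (\<sigma> s) t" "prefix (\<sigma> s') t" for s s' t
    using that
  proof (induction s s' rule: list_induct2)
    case (Cons b c b' c')
    have *: "prefix (\<sigma> c @ [b]) t" "prefix (\<sigma> c' @ [b']) t"
      using Cons.prems \<sigma>_step by (meson prefix_order.trans)+
    then have "c = c'" using Cons.IH by (meson append_prefixD)
    with * show ?case by (auto simp: prefix_def)
  qed simp
  define S where "S = {t. \<exists>s. prefix t (\<sigma> s)}"
  have "perfect_tree S"
  proof (rule perfect_treeI)
    fix t assume "t \<in> S"
    then obtain s where "prefix t (\<sigma> s)" by (auto simp: S_def)
    moreover have "splits S (\<sigma> s)"
      using \<sigma>_step unfolding S_def splits_def by blast
    ultimately show "\<exists>u. prefix t u \<and> splits S u" by blast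
  qed (auto simp: S_def intro: prefix_order.trans)
  then have tree_S: "tree (Sacks S) = S" by (simp add: Sacks_inverse)
  have \<sigma>_tree: "\<sigma> (s' @ s) \<in> tree (W s)" for s s'
    using W_append[of s' s] splits_in_tree[OF \<sigma>_W] by (auto simp: less_eq_sacks_def)
  show ?thesis
  proof
    show "Sacks S \<le> T"
      unfolding less_eq_sacks_def tree_S using \<sigma>_tree[of _ "[]"]
      by (auto simp: S_def W intro: tree_prefix)
    fix n
    have "finite {s :: bool list. length s \<le> Suc n}"
      using finite_lists_length_le[of "UNIV :: bool set"] by simp
    then have "finite ((\<lambda>s. length (\<sigma> s)) ` {s. length s \<le> Suc n})" by (rule finite_imageI)
    then obtain m where m: "\<And>s. length s \<le> Suc n \<Longrightarrow> length (\<sigma> s) < m"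
      unfolding finite_nat_set_iff_bounded by auto
    have long: "\<exists>s' s. s0 = s' @ s \<and> length s = Suc n \<and> prefix (\<sigma> s) t"
      if "length t = m" "prefix t (\<sigma> s0)" for t s0
    proof -
      have "m \<le> length (\<sigma> s0)" using that prefix_length_le by auto
      then have len: "Suc n < length s0" using m[of s0] by (meson leD not_le)
      define s' s where "s' = take (length s0 - Suc n) s0" and "s = drop (length s0 - Suc n) s0"
      have s: "s0 = s' @ s" "length s = Suc n" using len by (auto simp: s'_def s_def)
      then have "prefix (\<sigma> s) t"
        using that m[of s] \<sigma>_append[of s s'] by (metis less_imp_le order_refl prefix_length_prefix)
      with s show ?thesis by blast
    qed
    have "restrict_tree (Sacks S) t \<in> D n" if t: "t \<in> S" "length t = m" for t
    proof -
      obtain s0 where s0: "prefix t (\<sigma> s0)" using t by (auto simp: S_def)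
      then obtain s' s where s: "s0 = s' @ s" "length s = Suc n" "prefix (\<sigma> s) t"
        using long t by blast
      have "t \<in> tree (W s)" using s0 \<sigma>_tree s by (blast intro: tree_prefix)
      have "x \<in> tree (W s)" if x: "x \<in> S" "prefix x t \<or> prefix t x" for x
        using x(2)
      proof
        assume "prefix x t"
        then show ?thesis using \<open>t \<in> tree (W s)\<close> by (rule tree_prefix[rotated])
      next
        assume "prefix t x"
        from x obtain s1 where s1: "prefix x (\<sigma> s1)" by (auto simp: S_def)
        with \<open>prefix t x\<close> obtain s1' s2 where "s1 = s1' @ s2" "length s2 = Suc n" "prefix (\<sigma> s2) t"
          using long[OF t(2) prefix_order.trans] by blast
        moreover from this have "s2 = s" using \<sigma>_inject s by simp
        ultimately show ?thesis using s1 \<sigma>_tree by (blast intro: tree_prefix)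
      qed
      then have "restrict_tree (Sacks S) t \<le> W s"
        using t by (auto simp: less_eq_sacks_def tree_restrict tree_S)
      moreover have "W s \<in> D n"
        using s(2) by (cases s) (auto simp: W next_tree)
      ultimately show ?thesis by (rule down[rotated])
    qed
    then show "\<exists>m. \<forall>t\<in>tree (Sacks S). length t = m \<longrightarrow> restrict_tree (Sacks S) t \<in> D n"
      unfolding tree_S by blast
  qed
qed

section \<open>Thin trees\<close>

definition code :: "nat set \<Rightarrow> nat \<Rightarrow> nat" where
  "code \<alpha> i = (\<Sum>k<i. if k \<in> \<alpha> then 2 ^ k else 0)"

lemma code_Suc: "code \<alpha> (Suc i) = code \<alpha> i + (if i \<in> \<alpha> then 2 ^ i else 0)"
  by (simp add: code_def)

lemma code_less: "code \<alpha> i < 2 ^ i"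
  by (induction i) (auto simp: code_Suc code_def[of _ 0])

lemma code_inject: "code \<alpha> i = code \<beta> i \<Longrightarrow> k < i \<Longrightarrow> k \<in> \<alpha> \<longleftrightarrow> k \<in> \<beta>"
proof (induction i)
  case (Suc i)
  then show ?case
    using code_less[of \<alpha> i] code_less[of \<beta> i]
    by (auto simp: code_Suc less_Suc_eq split: if_splits)
qed simp

definition interval :: "nat set \<Rightarrow> nat \<Rightarrow> nat set" where
  "interval X n = {enumerate X n..<enumerate X (n + 1)}"

definition zone :: "nat set \<Rightarrow> nat set \<Rightarrow> nat set" where
  "zone X \<alpha> = (\<Union>i. interval X (2 ^ i + code \<alpha> i))"

definition thin :: "nat set \<Rightarrow> nat set \<Rightarrow> sacks \<Rightarrow> bool" where
  "thin X \<alpha> T \<longleftrightarrow> (\<forall>t. splits (tree T) t \<longrightarrow> length t \<in> zone X \<alpha>)"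

lemma thin_mono: "thin X \<alpha> T \<Longrightarrow> S \<le> T \<Longrightarrow> thin X \<alpha> S"
  unfolding thin_def less_eq_sacks_def using splits_mono by blast

lemma interval_disjoint:
  assumes "infinite X" "l \<in> interval X m" "l \<in> interval X n"
  shows "m = n"
proof -
  have mono: "strict_mono (enumerate X)" using assms(1) by (rule strict_mono_enumerate)
  have "enumerate X m < enumerate X (n + 1)" "enumerate X n < enumerate X (m + 1)"
    using assms(2,3) unfolding interval_def by auto
  then show ?thesis using mono by (simp add: strict_mono_less)
qed

lemma thin_unique:
  assumes "infinite X" "thin X \<alpha> T" "thin X \<beta> T"
  shows "\<alpha> = \<beta>"
proof -
  have "k \<in> \<alpha> \<longleftrightarrow> k \<in> \<beta>" for k
  proof -
    obtain t where t: "splits (tree T) t" "enumerate X (2 ^ Suc k) \<le> length t"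
      using tree_splits_long[OF Nil_in_tree] by blast
    with assms obtain i j where i: "length t \<in> interval X (2 ^ i + code \<alpha> i)"
      and j: "length t \<in> interval X (2 ^ j + code \<beta> j)"
      unfolding thin_def zone_def by blast
    have eq: "2 ^ i + code \<alpha> i = 2 ^ j + code \<beta> j"
      using interval_disjoint[OF assms(1) i j] .
    have "i = j"
    proof (rule ccontr)
      assume "i \<noteq> j"
      then consider "Suc i \<le> j" | "Suc j \<le> i" by linarith
      then show False
      proof cases
        case 1
        then have "(2::nat) ^ Suc i \<le> 2 ^ j" by (intro power_increasing) auto
        with eq code_less[of \<alpha> i] show False by simp
      next
        case 2
        then have "(2::nat) ^ Suc j \<le> 2 ^ i" by (intro power_increasing) auto
        with eq code_less[of \<beta> j] show False by simp
      qed
    qed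
    have "enumerate X (2 ^ Suc k) < enumerate X (2 ^ i + code \<alpha> i + 1)"
      using i t(2) by (auto simp: interval_def)
    then have "2 ^ Suc k < 2 ^ i + code \<alpha> i + 1"
      using strict_mono_less[OF strict_mono_enumerate[OF assms(1)]] by blast
    then have "(2::nat) ^ Suc k < 2 ^ Suc i"
      using code_less[of \<alpha> i] unfolding power_Suc by linarith
    then have "Suc k < Suc i" by (rule power_less_imp_less_exp[rotated]) simp
    then have "k < i" by simp
    moreover have "code \<alpha> i = code \<beta> i" using eq \<open>i = j\<close> by simp
    ultimately show ?thesis by (rule code_inject[rotated])
  qed
  then show ?thesis by blast
qed

definition thinning :: "nat set \<Rightarrow> sacks \<Rightarrow> bool list set" where
  "thinning Z T = {t \<in> tree T. \<forall>k<length t.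
     k \<notin> Z \<longrightarrow> splits (tree T) (take k t) \<longrightarrow> \<not> t ! k}"

lemma thinning_snoc:
  "t @ [b] \<in> thinning Z T \<longleftrightarrow> t @ [b] \<in> tree T \<and> t \<in> thinning Z T \<and>
    (length t \<notin> Z \<longrightarrow> splits (tree T) t \<longrightarrow> \<not> b)"
  by (auto simp: thinning_def nth_append less_Suc_eq intro: tree_prefix)

lemma thinning_extend:
  assumes "t \<in> thinning Z T" "length t \<le> n"
  shows "\<exists>u\<in>thinning Z T. prefix t u \<and> length u = n"
  using assms(2)
proof (induction n rule: dec_induct)
  case base
  then show ?case using assms(1) by auto
next
  case (step n)
  then obtain u where u: "u \<in> thinning Z T" "prefix t u" "length u = n" by blast
  then have "u \<in> tree T" by (simp add: thinning_def)
  then obtain v where v: "v \<in> tree T" "prefix u v" "length v = Suc n"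
    using tree_extend[of u T "Suc n"] u by auto
  then obtain b where "v = u @ [b]"
    using u by (metis (no_types) append_eq_conv_conj butlast_snoc length_append_singleton
      prefix_def take_Suc_conv_app_nth take_all_iff lessI order_refl)
  then have "u @ [b] \<in> tree T" using v by simp
  then have "\<exists>b. u @ [b] \<in> thinning Z T"
    using u(1) by (cases "splits (tree T) u") (auto simp: thinning_snoc splits_def)
  then obtain b where "u @ [b] \<in> thinning Z T" by blast
  moreover have "prefix t (u @ [b])" "length (u @ [b]) = Suc n" using u by auto
  ultimately show ?case by blast
qed

lemma thinning_zone:
  assumes "t \<in> thinning Z T" "prefix t u" "u \<in> tree T" "{length t..<length u} \<subseteq> Z"
  shows "u \<in> thinning Z T"
  unfolding thinning_def
proof (rule CollectI, intro conjI allI impI)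
  fix k assume k: "k < length u" "k \<notin> Z" "splits (tree T) (take k u)"
  then have "k < length t" using assms(4) by (meson atLeastLessThan_iff not_le_imp_less subsetD)
  with assms k show "\<not> u ! k" by (auto simp: thinning_def prefix_def nth_append)
qed fact

lemma thinning:
  assumes "\<exists>\<^sub>\<infinity>a. \<exists>b. {a..<b} \<subseteq> Z \<and>
    (\<forall>t\<in>tree T. length t = a \<longrightarrow> (\<exists>u. prefix t u \<and> splits (tree T) u \<and> length u < b))"
  shows "perfect_tree (thinning Z T)" "splits (thinning Z T) t \<Longrightarrow> length t \<in> Z"
proof -
  show "perfect_tree (thinning Z T)"
  proof (rule perfect_treeI)
    show "thinning Z T \<noteq> {}" using Nil_in_tree[of T] by (force simp: thinning_def)
  next
    fix s t assume t: "t \<in> thinning Z T" "prefix s t"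
    then have "s \<in> tree T" by (auto simp: thinning_def intro: tree_prefix)
    moreover have "take k t = take k s" "t ! k = s ! k" "k < length t" if "k < length s" for k
      using t(2) that by (auto simp: prefix_def nth_append)
    ultimately show "s \<in> thinning Z T"
      using t(1) unfolding thinning_def by simp metis
  next
    fix t assume t: "t \<in> thinning Z T"
    from assms obtain a b where a: "length t \<le> a" "{a..<b} \<subseteq> Z" 
      "\<forall>t\<in>tree T. length t = a \<longrightarrow> (\<exists>u. prefix t u \<and> splits (tree T) u \<and> length u < b)"
      unfolding INFM_nat_le by blast
    with t obtain s where s: "s \<in> thinning Z T" "prefix t s" "length s = a"
      using thinning_extend by blast
    with a obtain u where u: "prefix s u" "splits (tree T) u" "length u < b"
      unfolding thinning_def by blast
    have "a \<le> length u" using u s prefix_length_le by blast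
    then have "length u \<in> Z" using u a(2) by auto
    have "u \<in> thinning Z T"
      by (rule thinning_zone[OF s(1) u(1) splits_in_tree[OF u(2)]]) (use s a u in force)
    then have "splits (thinning Z T) u"
      unfolding splits_def thinning_snoc using u(2) \<open>length u \<in> Z\<close> by (auto simp: splits_def)
    then show "\<exists>u. prefix t u \<and> splits (thinning Z T) u"
      using s(2) u(1) by (meson prefix_order.trans)
  qed
  show "length t \<in> Z" if "splits (thinning Z T) t"
    using that unfolding splits_def thinning_snoc by auto
qed

lemma splitting_bound:
  obtains g where "\<And>n. n < g n" "strict_mono g"
    "\<And>t. t \<in> tree T \<Longrightarrow> \<exists>u. prefix t u \<and> splits (tree T) u \<and> length u < g (length t)"
proof -
  define h where "h t = length (SOME u. prefix t u \<and> splits (tree T) u)" for t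
  have h: "\<exists>u. prefix t u \<and> splits (tree T) u \<and> length u = h t" if "t \<in> tree T" for t
    unfolding h_def using someI_ex[OF tree_splits[OF that]] by blast
  define g where "g n = Suc n + (\<Sum>t | length t \<le> n. h t)" for n
  have fin: "finite {t :: bool list. length t \<le> n}" for n
    using finite_lists_length_le[of "UNIV :: bool set"] by simp
  show ?thesis
  proof
    show "n < g n" for n by (simp add: g_def)
    show "strict_mono g"
    proof (rule strict_monoI)
      fix m n :: nat assume "m < n"
      then have "(\<Sum>t | length t \<le> m. h t) \<le> (\<Sum>t | length t \<le> n. h t)"
        by (intro sum_mono2 fin) auto
      with \<open>m < n\<close> show "g m < g n" by (simp add: g_def)
    qed
    fix t assume "t \<in> tree T"
    moreover have "h t < g (length t)"
      using member_le_sum[of t "{s. length s \<le> length t}" h] fin by (simp add: g_def)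
    ultimately show "\<exists>u. prefix t u \<and> splits (tree T) u \<and> length u < g (length t)"
      using h by metis
  qed
qed

lemma thin_dense:
  assumes "weakly_dominating F"
  obtains X where "X \<in> F" "\<And>\<alpha>. \<exists>S\<le>T. thin X \<alpha> S"
proof -
  obtain g where g: "\<And>n. n < g n" "strict_mono g"
    "\<And>t. t \<in> tree T \<Longrightarrow> \<exists>u. prefix t u \<and> splits (tree T) u \<and> length u < g (length t)"
    by (rule splitting_bound) blast
  define y where "y n = (g ^^ n) 0" for n
  have y: "strict_mono y"
    using g(1) by (auto simp: y_def strict_mono_Suc_iff)
  then have "infinite (range y)"
    by (simp add: range_inj_infinite strict_mono_imp_inj_on)
  with assms obtain X where "X \<in> F" and X: "\<exists>\<^sub>\<infinity>i. \<forall>j<2 ^ i. 2 \<le>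
      card ({enumerate X (2 ^ i + j)..<enumerate X (2 ^ i + j + 1)} \<inter> range y)"
    unfolding weakly_dominating_def by blast
  from assms \<open>X \<in> F\<close> have "infinite X" unfolding weakly_dominating_def by auto
  then have X_mono: "strict_mono (enumerate X)" by (rule strict_mono_enumerate)
  have wide: "\<exists>u. prefix t u \<and> splits (tree T) u \<and> length u < b"
    if card: "2 \<le> card ({a..<b} \<inter> range y)" and t: "t \<in> tree T" "length t = a" for a b t
  proof -
    obtain B where "B \<subseteq> {a..<b} \<inter> range y" "card B = 2"
      using obtain_subset_with_card_n[OF card] by blast
    then obtain c d where "c \<in> {a..<b} \<inter> range y" "d \<in> {a..<b} \<inter> range y" "c \<noteq> d"
      unfolding card_2_iff by blast
    then obtain c d where cd: "c \<in> {a..<b} \<inter> range y" "d \<in> {a..<b} \<inter> range y" "c < d"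
      by (metis linorder_neqE_nat)
    then obtain m n where mn: "c = y m" "d = y n" by blast
    with cd y have "Suc m \<le> n" by (simp add: strict_mono_less)
    then have "y (Suc m) \<le> y n" using y by (simp add: strict_mono_less_eq)
    then have gc: "g c \<le> d" using mn by (simp add: y_def)
    obtain s where s: "s \<in> tree T" "prefix t s" "length s = c"
      using tree_extend[of t T c] t cd by auto
    with g(3) obtain u where "prefix s u" "splits (tree T) u" "length u < g c" by blast
    with s gc cd show ?thesis by (meson IntD1 atLeastLessThan_iff less_trans order_less_le_trans prefix_order.trans)
  qed
  have "\<exists>S\<le>T. thin X \<alpha> S" for \<alpha>
  proof -
    have inf: "\<exists>\<^sub>\<infinity>a. \<exists>b. {a..<b} \<subseteq> zone X \<alpha> \<and>
      (\<forall>t\<in>tree T. length t = a \<longrightarrow> (\<exists>u. prefix t u \<and> splits (tree T) u \<and> length u < b))"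
      unfolding INFM_nat_le
    proof
      fix m
      from X obtain i where i: "m \<le> i" "2 \<le>
          card ({enumerate X (2 ^ i + code \<alpha> i)..<enumerate X (2 ^ i + code \<alpha> i + 1)} \<inter> range y)"
        unfolding INFM_nat_le using code_less by blast
      have "i \<le> 2 ^ i + code \<alpha> i" using less_exp[of i] by linarith
      also have "\<dots> \<le> enumerate X (2 ^ i + code \<alpha> i)" by (rule strict_mono_imp_increasing[OF X_mono])
      finally have "m \<le> enumerate X (2 ^ i + code \<alpha> i)" using i by simp
      moreover have "{enumerate X (2 ^ i + code \<alpha> i)..<enumerate X (2 ^ i + code \<alpha> i + 1)} \<subseteq> zone X \<alpha>"
        unfolding zone_def interval_def by blast
      ultimately show "\<exists>a\<ge>m. \<exists>b. {a..<b} \<subseteq> zone X \<alpha> \<and>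
        (\<forall>t\<in>tree T. length t = a \<longrightarrow> (\<exists>u. prefix t u \<and> splits (tree T) u \<and> length u < b))"
        using wide[OF i(2)] by blast
    qed
    have "tree (Sacks (thinning (zone X \<alpha>) T)) = thinning (zone X \<alpha>) T"
      by (rule Sacks_inverse) (simp add: thinning(1)[OF inf])
    moreover have "thinning (zone X \<alpha>) T \<subseteq> tree T" by (auto simp: thinning_def)
    ultimately show ?thesis
      using thinning(2)[OF inf] unfolding thin_def less_eq_sacks_def by metis
  qed
  with \<open>X \<in> F\<close> show ?thesis by (rule that)
qed

text \<open>A tree that is thin for as many members of a finite \<open>F\<close> as possible could be thinned out
  further, for a code that it does not use yet.\<close>

lemma weakly_dominating_infinite:
  assumes F: "weakly_dominating F"
  shows "infinite F"
proof
  assume fin: "finite F"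
  define A where "A T = {X \<in> F. \<exists>\<alpha>. thin X \<alpha> T}" for T
  have "\<exists>T. \<forall>S. card (A S) \<le> card (A T)"
  proof -
    have "card (A T) \<le> card F" for T
      unfolding A_def using fin by (auto intro: card_mono)
    then have "finite (range (\<lambda>T. card (A T)))"
      by (auto simp: finite_nat_set_iff_bounded_le)
    then have "Max (range (\<lambda>T. card (A T))) \<in> range (\<lambda>T. card (A T))"
      and "\<And>S. card (A S) \<le> Max (range (\<lambda>T. card (A T)))"
      by (auto intro: Max_in)
    then show ?thesis by (metis (no_types, lifting) imageE)
  qed
  then obtain T where T: "\<And>S. card (A S) \<le> card (A T)" by blast
  have "finite (\<Union>X\<in>F. {\<alpha>. thin X \<alpha> T})"
  proof (rule finite_UN_I[OF fin])
    fix X assume "X \<in> F"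
    then have "infinite X" using F by (auto simp: weakly_dominating_def)
    then have "\<forall>\<alpha>\<in>{\<alpha>. thin X \<alpha> T}. \<forall>\<beta>\<in>{\<alpha>. thin X \<alpha> T}. \<alpha> = \<beta>"
      using thin_unique by blast
    then show "finite {\<alpha>. thin X \<alpha> T}"
      by (metis finite.emptyI finite_insert finite_subset insertI1 subsetI)
  qed
  moreover have "infinite (UNIV :: nat set set)"
    by (simp add: Finite_Set.finite_set)
  ultimately obtain \<alpha> where \<alpha>: "\<And>X. X \<in> F \<Longrightarrow> \<not> thin X \<alpha> T"
    by (metis (mono_tags, lifting) UN_I ex_new_if_finite mem_Collect_eq)
  obtain X S where X: "X \<in> F" "S \<le> T" "thin X \<alpha> S"
    using thin_dense[OF F] by metis
  have "infinite X" using F X by (auto simp: weakly_dominating_def)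
  with X \<alpha> have "X \<notin> A T"
    unfolding A_def using thin_mono thin_unique by blast
  moreover have "A T \<subseteq> A S" "X \<in> A S"
    using X unfolding A_def by (auto intro: thin_mono)
  ultimately have "A T \<subset> A S" by blast
  then have "card (A T) < card (A S)"
    by (rule psubset_card_mono[rotated]) (use fin in \<open>auto simp: A_def\<close>)
  with T[of S] show False by simp
qed

section \<open>Names for reals\<close>

definition omega :: "('i, 'p::order_top) name" where
  "omega = ordinal_check natLeq"

definition numeral_check :: "nat \<Rightarrow> ('i, 'p::order_top) name" where
  "numeral_check = segment_check natLeq"

text \<open>The name is read off continuously from the generic branch: \<open>n\<close> belongs to the real
  coded by \<open>\<alpha>\<close> iff the branch passes through some \<open>t\<close> with \<open>to_nat (t, n) \<in> \<alpha>\<close>.\<close>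

definition real_elts :: "nat set \<Rightarrow> (('i, sacks) name \<times> sacks) set" where
  "real_elts \<alpha> = (\<lambda>(t, n). (numeral_check n, restrict_tree top t)) ` {x. to_nat x \<in> \<alpha>}"

definition real_name :: "nat set \<Rightarrow> ('i, sacks) name" where
  "real_name \<alpha> = name_of (real_elts \<alpha>)"

definition ground_code :: "nat set \<Rightarrow> nat set" where
  "ground_code S = (\<lambda>n. to_nat ([] :: bool list, n)) ` S"

lemma restrict_tree_Nil: "restrict_tree T [] = T"
  by (simp add: restrict_tree_def tree_inverse)

lemma card_sacks: "|UNIV :: sacks set| \<le>o |UNIV :: nat set set|"
proof -
  have "inj (\<lambda>T. to_nat ` tree T)"
    by (auto simp: inj_def inj_image_eq_iff tree_inject)
  then show ?thesis unfolding card_of_ordLeq[symmetric] by blast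
qed

locale large_index =
  fixes index :: "'i itself"
  assumes large: "|UNIV :: nat set set| \<le>o |UNIV :: 'i set|"
begin

lemma card_nat_le: "|UNIV :: nat set| \<le>o |UNIV :: 'i set|"
proof -
  have "inj (\<lambda>n :: nat. {n})" by (auto simp: inj_def)
  then have "|UNIV :: nat set| \<le>o |UNIV :: nat set set|" unfolding card_of_ordLeq[symmetric] by blast
  then show ?thesis using large by (rule ordLeq_transitive)
qed

lemma infinite_index: "infinite (UNIV :: 'i set)"
  using card_nat_le card_of_ordLeq_infinite infinite_UNIV_nat by blast

lemma elts_omega: "elts (omega :: ('i, 'p::order_top) name) = (\<lambda>n. (numeral_check n, top)) ` UNIV"
  unfolding omega_def numeral_check_def
  by (subst elts_ordinal_check) (simp_all add: Field_natLeq card_nat_le)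

lemma numeral_check_inject:
  "forces_eq p (numeral_check m :: ('i, 'p::order_top) name) (numeral_check n) \<Longrightarrow> m = n"
  unfolding numeral_check_def
  by (rule segment_check_inject[OF natLeq_Well_order]) (auto simp: Field_natLeq card_nat_le)

lemma elts_real_name: "elts (real_name \<alpha> :: ('i, sacks) name) = real_elts \<alpha>"
proof -
  have "|{x :: bool list \<times> nat. to_nat x \<in> \<alpha>}| \<le>o |UNIV :: nat set|"
    unfolding card_of_ordLeq[symmetric] by (intro exI[of _ to_nat]) (auto simp: inj_on_def)
  then have "|real_elts \<alpha> :: (('i, sacks) name \<times> sacks) set| \<le>o |UNIV :: 'i set|"
    unfolding real_elts_def
    by (meson card_of_image ordLeq_transitive card_nat_le)
  then show ?thesis unfolding real_name_def by (rule elts_name_of)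
qed

lemma real_name_subset:
  assumes "forces_mem p x (real_name \<alpha> :: ('i, sacks) name)"
  shows "forces_mem p x omega"
proof (rule forces_mem_dense)
  fix q assume "q \<le> p"
  with assms have "forces_mem q x (real_name \<alpha>)" by (rule forces_mem_mono)
  then obtain r d s where r: "r \<le> q" "(d, s) \<in> real_elts \<alpha>" "r \<le> s" "forces_eq r x d"
    using forces_memD elts_real_name by metis
  then obtain n where "d = numeral_check n" by (auto simp: real_elts_def)
  then have "forces_mem r d omega"
    by (auto intro!: forces_mem_elts[where s = top] simp: elts_omega)
  with r show "\<exists>r\<le>q. forces_mem r x omega"
    by (meson forces_eq_sym forces_mem_cong_left)
qed

lemma real_name_dense:
  fixes y :: "('i, sacks) name"
  assumes y: "\<And>q x. q \<le> p \<Longrightarrow> forces_mem q x y \<Longrightarrow> forces_mem q x omega"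
  shows "\<exists>q\<le>p. \<exists>\<alpha>. forces_eq q y (real_name \<alpha>)"
proof -
  define D where "D n = {q. forces_mem q (numeral_check n) y \<or>
    (\<forall>r\<le>q. \<not> forces_mem r (numeral_check n) y)}" for n
  obtain S where S: "S \<le> p" 
    and D: "\<And>n. \<exists>m. \<forall>t\<in>tree S. length t = m \<longrightarrow> restrict_tree S t \<in> D n"
  proof (rule fusion[of D p])
    show "q \<in> D n" if "r \<in> D n" "q \<le> r" for n q r
      using that unfolding D_def by (auto intro: forces_mem_mono order_trans)
    show "\<exists>r\<le>q. r \<in> D n" for n q
      unfolding D_def by blast
  qed blast
  define \<alpha> where "\<alpha> = to_nat ` {(t, n). t \<in> tree S \<and>
    forces_mem (restrict_tree S t) (numeral_check n) y}"
  have elts: "real_elts \<alpha> = {(numeral_check n :: ('i, sacks) name, restrict_tree top t) |t n. t \<in> tree S \<and>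
    forces_mem (restrict_tree S t) (numeral_check n) y}"
    unfolding real_elts_def \<alpha>_def by (auto simp: image_iff)
  have "forces_eq S y (real_name \<alpha>)"
    unfolding forces_eq.simps[of S y] elts_real_name
  proof (intro conjI ballI allI impI; clarify)
    fix c s q assume c: "(c, s) \<in> elts y" "q \<le> S" "q \<le> s"
    show "forces_mem q c (real_name \<alpha>)"
    proof (rule forces_mem_dense)
      fix q0 assume q0: "q0 \<le> q"
      then have mem: "forces_mem q0 c y" using c by (meson forces_mem_elts order_trans)
      have "q0 \<le> p" using q0 c S by (meson order_trans)
      then have "forces_mem q0 c omega" using mem by (rule y)
      then obtain r d s where "r \<le> q0" "(d, s) \<in> elts (omega :: ('i, sacks) name)" "forces_eq r c d"
        by (rule forces_memD)
      then obtain n where r: "r \<le> q0" "forces_eq r c (numeral_check n)" by (auto simp: elts_omega)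
      then have n: "forces_mem r (numeral_check n) y"
        using mem by (meson forces_mem_cong_left forces_mem_mono)
      have "r \<le> S" using r q0 c by (meson order_trans)
      obtain m where m: "\<forall>t\<in>tree S. length t = m \<longrightarrow> restrict_tree S t \<in> D n" using D by blast
      obtain t where t: "t \<in> tree r" "length t = m"
        using tree_extend[OF Nil_in_tree] by (metis list.size(3) zero_le)
      then have tS: "t \<in> tree S" using \<open>r \<le> S\<close> by (auto simp: less_eq_sacks_def)
      have le: "restrict_tree r t \<le> restrict_tree S t" "restrict_tree r t \<le> r"
        "restrict_tree r t \<le> restrict_tree top t"
        using \<open>r \<le> S\<close> t by (auto intro: restrict_tree_mono restrict_tree_le)
      then have "forces_mem (restrict_tree r t) (numeral_check n) y" using n forces_mem_mono by blast
      then have "forces_mem (restrict_tree S t) (numeral_check n) y"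
        using m tS t le unfolding D_def by blast
      then have "(numeral_check n, restrict_tree top t) \<in> elts (real_name \<alpha> :: ('i, sacks) name)"
        using tS unfolding elts_real_name elts by blast
      then have "forces_mem (restrict_tree r t) (numeral_check n) (real_name \<alpha> :: ('i, sacks) name)"
        using le forces_mem_elts by blast
      moreover have "forces_eq (restrict_tree r t) c (numeral_check n)"
        using le r forces_eq_mono by blast
      ultimately show "\<exists>r\<le>q0. forces_mem r c (real_name \<alpha>)"
        using le r by (meson forces_eq_sym forces_mem_cong_left order_trans)
    qed
  next
    fix c :: "('i, sacks) name" and s q assume c: "(c, s) \<in> real_elts \<alpha>" "q \<le> S" "q \<le> s"
    then obtain t n where "c = numeral_check n" "s = restrict_tree top t" "t \<in> tree S"
      "forces_mem (restrict_tree S t) c y"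
      unfolding elts by blast
    with c show "forces_mem q c y"
      using le_restrict_tree forces_mem_mono by blast
  qed
  with S show ?thesis by blast
qed

lemma ground_code_inject:
  assumes "forces_eq p (real_name (ground_code A) :: ('i, sacks) name) (real_name (ground_code B))"
  shows "A = B"
proof -
  have elts: "real_elts (ground_code S) = (\<lambda>n. (numeral_check n :: ('i, sacks) name, top)) ` S" for S
    by (auto simp: real_elts_def ground_code_def restrict_tree_Nil image_iff) 
  have "A \<subseteq> B"
    if "forces_eq p (real_name (ground_code A) :: ('i, sacks) name) (real_name (ground_code B))" for A B
  proof
    fix n assume "n \<in> A"
    then have "(numeral_check n, top) \<in> elts (real_name (ground_code A) :: ('i, sacks) name)"
      unfolding elts_real_name elts by blast
    with that have "forces_mem p (numeral_check n) (real_name (ground_code B) :: ('i, sacks) name)"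
      using forces_eq_elts top_greatest by blast
    then show "n \<in> B"
      by (rule forces_memD) (auto simp: elts_real_name elts dest: numeral_check_inject)
  qed
  with assms show ?thesis using forces_eq_sym by blast
qed

definition reals :: "('i, sacks) name" where
  "reals = name_of ((\<lambda>a. (a, top)) ` range real_name)"

lemma elts_reals: "elts reals = (\<lambda>a. (a, top)) ` range real_name"
  unfolding reals_def image_image
  by (rule elts_name_of) (meson card_of_image ordLeq_transitive large)

lemma is_powerset_reals: "p \<tturnstile> is_powerset reals omega"
  unfolding is_powerset_def forces.simps(5) forces_Iff forces_Imp forces.simps(2)
proof (intro allI impI iffI)
  fix y x :: "('i, sacks) name" and q r
  assume y: "forces_mem q y reals" and x: "r \<le> q" "forces_mem r x y"
  show "forces_mem r x omega"
  proof (rule forces_mem_dense)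
    fix r' assume r': "r' \<le> r"
    then have "forces_mem r' y reals" "forces_mem r' x y"
      using x y by (meson forces_mem_mono order_trans)+
    then obtain u d s where "u \<le> r'" "(d, s) \<in> elts reals" "forces_eq u y d"
      by (meson forces_memD)
    moreover from this \<open>forces_mem r' x y\<close> have "forces_mem u x d"
      by (meson forces_mem_cong_right forces_mem_mono)
    ultimately show "\<exists>r\<le>r'. forces_mem r x omega"
      by (auto simp: elts_reals intro: real_name_subset)
  qed
next
  fix y :: "('i, sacks) name" and q
  assume y: "\<forall>x. \<forall>r\<le>q. forces_mem r x y \<longrightarrow> forces_mem r x omega"
  show "forces_mem q y reals"
  proof (rule forces_memI)
    fix q' assume "q' \<le> q"
    then have "\<exists>r\<le>q'. \<exists>\<alpha>. forces_eq r y (real_name \<alpha>)"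
      using y by (intro real_name_dense) (meson order_trans)
    then show "\<exists>r\<le>q'. \<exists>d s. (d, s) \<in> elts reals \<and> r \<le> s \<and> forces_eq r y d"
      unfolding elts_reals using top_greatest by blast
  qed
qed

end

section \<open>The collapse\<close>

locale collapse = large_index index for index :: "'i itself" +
  fixes F :: "nat set set" and \<kappa> :: "nat set rel"
  assumes F: "weakly_dominating F" and \<kappa>: "Well_order \<kappa>" "Field \<kappa> = F"
begin

lemma infinite_member: "r \<in> F \<Longrightarrow> infinite r"
  using F by (auto simp: weakly_dominating_def)

lemma card_F: "|Field \<kappa>| \<le>o |UNIV :: 'i set|"
  by (rule ordLeq_transitive[OF _ large]) (rule card_of_mono1, simp)

definition pairing :: "nat set \<times> nat \<Rightarrow> nat set" where
  "pairing = (SOME pairing. bij_betw pairing (F \<times> UNIV) F)"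

lemma pairing: "bij_betw pairing (F \<times> UNIV) F"
proof -
  have "|UNIV :: nat set| \<le>o |F|"
    using weakly_dominating_infinite[OF F] infinite_iff_card_of_nat by blast
  moreover have "F \<noteq> {}" using weakly_dominating_infinite[OF F] by auto
  ultimately have "|F \<times> (UNIV :: nat set)| =o |F|"
    using weakly_dominating_infinite[OF F] card_of_Times_infinite by blast
  then show ?thesis unfolding pairing_def card_of_ordIso[symmetric] by (rule someI_ex)
qed

abbreviation index_name :: "nat set \<Rightarrow> nat \<Rightarrow> ('i, sacks) name" where
  "index_name r n \<equiv> segment_check \<kappa> (pairing (r, n))"

lemma index_name_inject:
  assumes "r \<in> F" "r' \<in> F" "forces_eq p (index_name r n) (index_name r' n')"
  shows "r = r' \<and> n = n'"
proof -
  have "pairing (r, n) \<in> F" "pairing (r', n') \<in> F" using pairing assms by (auto simp: bij_betw_def)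
  then have "pairing (r, n) = pairing (r', n')"
    using segment_check_inject[OF \<kappa>(1) card_F] \<kappa>(2) assms(3) by blast
  then show ?thesis using pairing assms by (auto simp: bij_betw_def inj_on_def)
qed

definition spare_name :: "nat set \<Rightarrow> nat \<Rightarrow> ('i, sacks) name" where
  "spare_name r n = real_name (ground_code (to_nat ` insert (False, n) (Pair True ` r)))"

lemma spare_name_inject:
  assumes "forces_eq p (spare_name r n) (spare_name r' n')"
  shows "r = r' \<and> n = n'"
proof -
  have "insert (False, n) (Pair True ` r) = insert (False, n') (Pair True ` r')"
    using ground_code_inject[OF assms[unfolded spare_name_def]] by (simp only: inj_image_eq_iff[OF inj_to_nat])
  then have "(False, k) \<in> insert (False, n) (Pair True ` r) \<longleftrightarrow>
      (False, k) \<in> insert (False, n') (Pair True ` r')"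
    and "(True, k) \<in> insert (False, n) (Pair True ` r) \<longleftrightarrow>
      (True, k) \<in> insert (False, n') (Pair True ` r')" for k
    by blast+
  then show ?thesis by auto
qed

text \<open>In the extension, \<open>H(r)\<close> is the real coded by the unique \<open>u\<close> such that the generic filter
  contains a tree that is thin for \<open>r\<close> and \<open>u\<close>. The condition \<open>least_code p r u\<close> says that \<open>p\<close>
  forces \<open>H(r)\<close> to be coded by \<open>u\<close>, not to be a spare real, and to differ from all earlier \<open>H(r')\<close>.\<close>

definition least_code :: "sacks \<Rightarrow> nat set \<Rightarrow> nat set \<Rightarrow> bool" where
  "least_code p r u \<longleftrightarrow> thin r u p \<and>
     (\<forall>r'\<in>F. \<forall>n. \<forall>q\<le>p. \<not> forces_eq q (real_name u) (spare_name r' n)) \<and>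
     (\<forall>r'\<in>underS \<kappa> r. \<forall>u'. \<forall>q\<le>p. thin r' u' q \<longrightarrow>
        \<not> forces_eq q (real_name u :: ('i, sacks) name) (real_name u'))"

lemma least_code_mono: "least_code p r u \<Longrightarrow> q \<le> p \<Longrightarrow> least_code q r u"
  unfolding least_code_def using thin_mono order_trans by blast

lemma least_code_not_spare:
  "least_code p r u \<Longrightarrow> r' \<in> F \<Longrightarrow> \<not> forces_eq p (real_name u) (spare_name r' n)"
  unfolding least_code_def by blast

lemma least_code_unique:
  assumes "least_code p r u" "least_code p r u'" "r \<in> F"
  shows "u = u'"
  using assms thin_unique infinite_member unfolding least_code_def by blast

lemma least_code_inject:
  assumes "least_code p r u" "least_code p r' u'" "r \<in> F" "r' \<in> F"
    and eq: "forces_eq p (real_name u :: ('i, sacks) name) (real_name u')"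
  shows "r = r'"
proof (rule ccontr)
  assume "r \<noteq> r'"
  then have "r \<in> underS \<kappa> r' \<or> r' \<in> underS \<kappa> r"
    using \<kappa> assms(3,4) unfolding well_order_on_def linear_order_on_def total_on_def underS_def
    by blast
  with assms forces_eq_sym[OF eq] show False
    unfolding least_code_def by blast
qed

lemma least_code_exists:
  assumes "\<And>r n q. q \<le> p \<Longrightarrow> r \<in> F \<Longrightarrow> \<not> forces_eq q (real_name u) (spare_name r n)"
  shows "\<exists>q\<le>p. \<exists>r\<in>F. \<exists>u'. least_code q r u' \<and>
    forces_eq q (real_name u :: ('i, sacks) name) (real_name u')"
proof -
  define A where "A = {r \<in> F. \<exists>q\<le>p. \<exists>u'. thin r u' q \<and>
    forces_eq q (real_name u :: ('i, sacks) name) (real_name u')}"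
  obtain X where "X \<in> F" "\<exists>q\<le>p. thin X u q" using thin_dense[OF F] by metis
  then have "X \<in> A" unfolding A_def using forces_eq_refl by blast
  moreover have "wf (\<kappa> - Id)" using \<kappa>(1) by (simp add: well_order_on_def)
  ultimately obtain r where r: "r \<in> A" "\<And>r'. (r', r) \<in> \<kappa> - Id \<Longrightarrow> r' \<notin> A"
    by (metis wfE_min)
  then obtain q u' where q: "r \<in> F" "q \<le> p" "thin r u' q"
      "forces_eq q (real_name u :: ('i, sacks) name) (real_name u')"
    unfolding A_def by blast
  have eq: "forces_eq q' (real_name u) a" if "q' \<le> q" "forces_eq q' (real_name u') a"
    for q' and a :: "('i, sacks) name"
    using that q(4) by (meson forces_eq_mono forces_eq_trans)
  have "least_code q r u'"
    unfolding least_code_def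
  proof (intro conjI ballI allI impI notI)
    fix r' n q' assume "r' \<in> F" "q' \<le> q" "forces_eq q' (real_name u') (spare_name r' n)"
    with eq assms q(2) show False by (meson order_trans)
  next
    fix r' u'' q' assume *: "r' \<in> underS \<kappa> r" "q' \<le> q" "thin r' u'' q'"
      "forces_eq q' (real_name u' :: ('i, sacks) name) (real_name u'')"
    then have "(r', r) \<in> \<kappa> - Id" "r' \<in> F" using \<kappa>(2) by (auto simp: underS_def Field_def)
    moreover have "q' \<le> p" using * q by (meson order_trans)
    ultimately show False using * eq r(2) unfolding A_def by blast
  qed (rule q)
  with q show ?thesis by blast
qed

text \<open>The spare reals are shifted by one along \<open>{r} \<times> \<omega>\<close> whenever \<open>H(r)\<close> is the least
  representation of a real that is not spare. That real takes the place \<open>(r, 0)\<close>.\<close>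

inductive_set graph :: "(('i, sacks) name \<times> ('i, sacks) name \<times> sacks) set" where
  new: "r \<in> F \<Longrightarrow> least_code p r u \<Longrightarrow> (real_name u, index_name r 0, p) \<in> graph"
| shifted: "r \<in> F \<Longrightarrow> least_code p r u \<Longrightarrow> (spare_name r n, index_name r (Suc n), p) \<in> graph"
| unshifted: "r \<in> F \<Longrightarrow> (\<And>q u. q \<le> p \<Longrightarrow> \<not> least_code q r u) \<Longrightarrow>
    (spare_name r n, index_name r n, p) \<in> graph"

lemma graph_range:
  "(a, b, p) \<in> graph \<Longrightarrow> a \<in> range real_name \<and> b \<in> segment_check \<kappa> ` F"
  by (induction a b p rule: graph.induct) (use pairing in \<open>auto simp: bij_betw_def spare_name_def\<close>)

definition bijection :: "('i, sacks) name" where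
  "bijection = name_of {(opair a b, s) |a b s. (a, b, s) \<in> graph}"

lemma elts_bijection: "elts bijection = {(opair a b, s) |a b s. (a, b, s) \<in> graph}"
proof -
  let ?f = "\<lambda>(a, b, s). (opair a b :: ('i, sacks) name, s :: sacks)"
  let ?A = "range real_name \<times> segment_check \<kappa> ` F \<times> UNIV ::
    (('i, sacks) name \<times> ('i, sacks) name \<times> sacks) set"
  have "|range (real_name :: _ \<Rightarrow> ('i, sacks) name)| \<le>o |UNIV :: 'i set|"
    by (meson card_of_image ordLeq_transitive large)
  moreover have "|segment_check \<kappa> ` F :: ('i, sacks) name set| \<le>o |UNIV :: 'i set|"
    using card_F \<kappa>(2) by (metis card_of_image ordLeq_transitive)
  moreover have "|UNIV :: sacks set| \<le>o |UNIV :: 'i set|"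
    using card_sacks large by (rule ordLeq_transitive)
  ultimately have "|?A| \<le>o |UNIV :: 'i set|"
    using infinite_index
    by (intro card_of_Times_ordLeq_infinite_Field) (simp_all add: Field_card_of card_of_card_order_on)
  then have "|?f ` ?A| \<le>o |UNIV :: 'i set|"
    by (meson card_of_image ordLeq_transitive)
  moreover have "{(opair a b, s) |a b s. (a, b, s) \<in> graph} \<subseteq> ?f ` ?A"
    using graph_range by force
  ultimately have "|{(opair a b, s) |a b s. (a, b, s) \<in> graph}| \<le>o |UNIV :: 'i set|"
    by (meson card_of_mono1 ordLeq_transitive)
  then show ?thesis unfolding bijection_def by (rule elts_name_of)
qed

lemma graph_total: "\<exists>q\<le>p. \<exists>a b s. (a, b, s) \<in> graph \<and> q \<le> s \<and> forces_eq q (real_name u) a"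
proof (cases "\<exists>q\<le>p. \<exists>r\<in>F. \<exists>n. forces_eq q (real_name u) (spare_name r n)")
  case False
  then obtain q r u' where "q \<le> p" "r \<in> F" "least_code q r u'"
    "forces_eq q (real_name u :: ('i, sacks) name) (real_name u')"
    using least_code_exists by meson
  then show ?thesis using graph.new by blast
next
  case True
  then obtain q r n where q: "q \<le> p" "r \<in> F" "forces_eq q (real_name u) (spare_name r n)" by blast
  show ?thesis
  proof (cases "\<exists>q'\<le>q. \<exists>u. least_code q' r u")
    case True
    then obtain q' u' where q': "q' \<le> q" "least_code q' r u'" by blast
    moreover have "forces_eq q' (real_name u) (spare_name r n)"
      using q(3) q'(1) by (rule forces_eq_mono)
    moreover have "q' \<le> p" using q(1) q'(1) by simp
    ultimately show ?thesis using graph.shifted[OF q(2)] by blast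
  next
    case False
    then have "(spare_name r n, index_name r n, q) \<in> graph"
      using graph.unshifted[OF q(2)] by blast
    with q show ?thesis by blast
  qed
qed

lemma graph_onto:
  assumes "b \<in> F"
  shows "\<exists>q\<le>p. \<exists>a s. (a, segment_check \<kappa> b, s) \<in> graph \<and> q \<le> s"
proof -
  obtain r n where b: "b = pairing (r, n)" "r \<in> F"
    using pairing assms by (auto 0 4 simp: bij_betw_def elim!: equalityE)
  show ?thesis
  proof (cases "\<exists>q\<le>p. \<exists>u. least_code q r u")
    case True
    then obtain q u where "q \<le> p" "least_code q r u" by blast
    then show ?thesis
      using b graph.new graph.shifted by (cases n) blast+
  next
    case False
    then show ?thesis using b graph.unshifted by blast
  qed
qed

lemma graph_cases_below:
  assumes "(a, b, s) \<in> graph" "q \<le> s"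
  obtains (new) r u where "r \<in> F" "least_code q r u" "a = real_name u" "b = index_name r 0"
  | (shifted) r u n where "r \<in> F" "least_code q r u" "a = spare_name r n" "b = index_name r (Suc n)"
  | (unshifted) r n where "r \<in> F" "\<And>u. \<not> least_code q r u" "a = spare_name r n" "b = index_name r n"
  using assms(1)
proof cases
  case (new r u)
  with assms(2) that(1) show ?thesis using least_code_mono by blast
next
  case (shifted r u n)
  with assms(2) that(2) show ?thesis using least_code_mono by blast
next
  case (unshifted r n)
  with assms(2) that(3) show ?thesis by blast
qed

lemma graph_functional:
  assumes "(a, b, s) \<in> graph" "(a', b', s') \<in> graph" "q \<le> s" "q \<le> s'"
  shows "forces_eq q a a' \<longleftrightarrow> forces_eq q b b'"
proof -
  have not_spare: "\<not> forces_eq q (spare_name r' n) (real_name u)"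
    if "least_code q r u" "r' \<in> F" for r r' n u
    using least_code_not_spare[OF that] forces_eq_sym by blast
  have spare: "forces_eq q (spare_name r n) (spare_name r' n') \<longleftrightarrow> r = r' \<and> n = n'" for r r' n n'
    using spare_name_inject forces_eq_refl by blast
  have index: "forces_eq q (index_name r n) (index_name r' n') \<longleftrightarrow> r = r' \<and> n = n'"
    if "r \<in> F" "r' \<in> F" for r r' n n'
    using index_name_inject that forces_eq_refl by blast
  have real: "forces_eq q (real_name u :: ('i, sacks) name) (real_name u') \<longleftrightarrow> r = r'"
    if "least_code q r u" "least_code q r' u'" "r \<in> F" "r' \<in> F" for r r' u u'
    using least_code_inject[OF that] least_code_unique that forces_eq_refl by blast
  from assms(1,3) show ?thesis
  proof (cases rule: graph_cases_below)
    case 1: (new r u)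
    from assms(2,4) show ?thesis
    proof (cases rule: graph_cases_below)
      case (new r' u')
      with 1 show ?thesis by (simp add: real[of r u r' u'] index)
    next
      case (shifted r' u' n)
      with 1 show ?thesis by (simp add: least_code_not_spare index)
    next
      case (unshifted r' n)
      with 1 show ?thesis by (auto simp: least_code_not_spare index)
    qed
  next
    case 1: (shifted r u n)
    from assms(2,4) show ?thesis
    proof (cases rule: graph_cases_below)
      case (new r' u')
      with 1 show ?thesis by (simp add: not_spare index)
    next
      case (shifted r' u' n)
      with 1 show ?thesis by (simp add: spare index)
    next
      case (unshifted r' n)
      with 1 show ?thesis by (auto simp: spare index)
    qed
  next
    case 1: (unshifted r n)
    from assms(2,4) show ?thesis
    proof (cases rule: graph_cases_below)
      case (new r' u')
      with 1 show ?thesis by (auto simp: not_spare index)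
    next
      case (shifted r' u' n)
      with 1 show ?thesis by (auto simp: spare index)
    next
      case (unshifted r' n)
      with 1 show ?thesis by (simp add: spare index)
    qed
  qed
qed

lemma forces_continuum_eq_card:
  "p \<tturnstile> (continuum_eq_card (ordinal_check \<kappa>) :: ('i, sacks) fm)"
proof -
  have "p \<tturnstile> is_bijection bijection (reals :: ('i, sacks) name) (ordinal_check \<kappa>)"
  proof (rule forces_is_bijection[OF infinite_index elts_reals _ elts_bijection])
    show "elts (ordinal_check \<kappa> :: ('i, sacks) name) = (\<lambda>b. (b, top)) ` segment_check \<kappa> ` F"
      using elts_ordinal_check[OF card_F] \<kappa>(2) by (simp add: image_image)
  next
    fix a :: "('i, sacks) name" and p assume "a \<in> range real_name"
    then show "\<exists>q\<le>p. \<exists>a' b s. (a', b, s) \<in> graph \<and> q \<le> s \<and> forces_eq q a a'"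
      using graph_total by auto
  next
    fix b :: "('i, sacks) name" and p assume "b \<in> segment_check \<kappa> ` F"
    then show "\<exists>q\<le>p. \<exists>a b' s. (a, b', s) \<in> graph \<and> q \<le> s \<and> forces_eq q b b'"
      using graph_onto[of _ p] forces_eq_refl by blast
  qed (use graph_range graph_functional in blast)+
  with is_powerset_reals[of p] show ?thesis
    unfolding continuum_eq_card_def same_cardinality_def omega_def
    by (intro forces_ExistsI[where x = reals]) (auto simp del: forces.simps(3) intro!: forces_ExistsI)
qed

end

theorem theorem2p5:
  assumes "|UNIV :: nat set set| \<le>o |UNIV :: 'i set|"
  shows "(top :: sacks) \<tturnstile> (continuum_eq_card (ordinal_check b_plus_epsilon) :: ('i, sacks) fm)"
proof -
  obtain F where F: "weakly_dominating F" "b_plus_epsilon = |F|"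
    using b_plus_epsilon by blast
  interpret collapse "TYPE('i)" F b_plus_epsilon
  proof
    show "Well_order b_plus_epsilon" unfolding F by (rule card_of_Well_order)
    show "Field b_plus_epsilon = F" unfolding F by (rule Field_card_of)
  qed (fact assms F(1))+
  show ?thesis by (rule forces_continuum_eq_card)
qed

end
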